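(* Let $k$ be a positive integer, let $\eta_k$ be the smallest positive solution to the equation $2^k\eta=e^{\eta-1}$, and let $\zeta_k=e2^k$. Let $P_n$ be the probability that a uniformly random $k$-apex forest with $n$ vertices is $2$-connected. Then, as $n\to\infty$ with $k$ fixed, $$P_n=\Theta\big((\zeta_k\eta_k)^{-n}\big)=\Theta\big((e2^k\eta_k)^{-n}\big)=\Theta\big(e^{-\eta_k n}\big).$$
   Context: All graphs are finite, simple and labelled. A $k$-apex forest is a graph that can be reduced to a forest by removing at most $k$ vertices. The uniformly random $k$-apex forest with $n$ vertices is chosen uniformly among all $k$-apex forests (not necessarily connected) with vertex set $\{1,\dots,n\}$. A graph is $2$-connected if it is connected, has at least two vertices and has no cutvertex. The notation $a_n=\Theta(b_n)$ means that there are positive constants $c,c'$ (which may depend on $k$) with $c\,b_n\le a_n\le c'\,b_n$ for all sufficiently large $n$. *)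

theory Defs
  imports "HOL-Probability.Probability" "HOL-Library.Landau_Symbols" "Graph_Theory.Graph_Theory"
begin

text \<open>
  A finite simple graph is a symmetric, loop-free digraph without parallel arcs (\<^locale>\<open>pair_graph\<close>):
  every edge is present as two opposite arcs. The library's \<^const>\<open>forest\<close> is therefore not
  the right notion here, because there an edge traversed back and forth counts as a cycle. An
  undirected cycle is a cycle of length at least three.
\<close>

definition undirected_forest :: "('a, 'b) pre_digraph \<Rightarrow> bool" where
  "undirected_forest G \<longleftrightarrow> \<not> (\<exists>p. pre_digraph.cycle G p \<and> 3 \<le> length p)"

definition apex_forest :: "nat \<Rightarrow> ('a, 'b) pre_digraph \<Rightarrow> bool" where
  "apex_forest k G \<longleftrightarrow>
     (\<exists>S \<subseteq> verts G. finite S \<and> card S \<le> k \<and> undirected_forest (G \<restriction> (verts G - S)))"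

definition cutvertex :: "('a, 'b) pre_digraph \<Rightarrow> 'a \<Rightarrow> bool" where
  "cutvertex G v \<longleftrightarrow> v \<in> verts G \<and>
     (\<exists>u \<in> verts G - {v}. \<exists>w \<in> verts G - {v}.
        u \<rightarrow>\<^sup>*\<^bsub>G\<^esub> w \<and> \<not> u \<rightarrow>\<^sup>*\<^bsub>G \<restriction> (verts G - {v})\<^esub> w)"

text \<open>The unqualified name \<open>connected\<close> may refer to topological connectedness.\<close>

definition two_connected :: "('a, 'b) pre_digraph \<Rightarrow> bool" where
  "two_connected G \<longleftrightarrow>
     Digraph_Component.connected G \<and> 2 \<le> card (verts G) \<and> \<not> (\<exists>v. cutvertex G v)"

definition labelled_graphs :: "nat \<Rightarrow> nat pair_pre_digraph set" where
  "labelled_graphs n = {G. pair_graph G \<and> pverts G = {1..n}}"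

definition apex_forests :: "nat \<Rightarrow> nat \<Rightarrow> nat pair_pre_digraph set" where
  "apex_forests k n = {G \<in> labelled_graphs n. apex_forest k (with_proj G)}"

definition random_apex_forest :: "nat \<Rightarrow> nat \<Rightarrow> nat pair_pre_digraph pmf" where
  "random_apex_forest k n = pmf_of_set (apex_forests k n)"

definition prob_two_connected :: "nat \<Rightarrow> nat \<Rightarrow> real" where
  "prob_two_connected k n =
     measure_pmf.prob (random_apex_forest k n) {G. two_connected (with_proj G)}"

definition eta :: "nat \<Rightarrow> real" where
  "eta k = (LEAST x. 0 < x \<and> 2 ^ k * x = exp (x - 1))"

definition zeta :: "nat \<Rightarrow> real" where
  "zeta k = exp 1 * 2 ^ k"

text \<open>
  The uniform distribution and the least solution are well defined.
\<close>

lemma finite_apex_forests: "finite (apex_forests k n)"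
proof -
  have "apex_forests k n \<subseteq>
      (\<lambda>A. \<lparr>pverts = {1..n}, parcs = A\<rparr>) ` Pow ({1..n} \<times> {1..n})"
  proof
    fix G assume "G \<in> apex_forests k n"
    hence g: "pair_graph G" and v: "pverts G = {1..n}"
      by (auto simp: apex_forests_def labelled_graphs_def)
    interpret pair_graph G by (rule g)
    have "parcs G \<subseteq> {1..n} \<times> {1..n}"
      using arc_fst_in_verts arc_snd_in_verts v by fastforce
    moreover have "G = \<lparr>pverts = {1..n}, parcs = parcs G\<rparr>" using v by simp
    ultimately show "G \<in> (\<lambda>A. \<lparr>pverts = {1..n}, parcs = A\<rparr>) ` Pow ({1..n} \<times> {1..n})"
      by blast
  qed
  thus ?thesis by (rule finite_subset) auto
qed

lemma apex_forests_nonempty: "apex_forests k n \<noteq> {}"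
proof -
  let ?G = "\<lparr>pverts = {1..n}, parcs = {}\<rparr> :: nat pair_pre_digraph"
  have g: "pair_graph ?G"
    by unfold_locales (auto simp: symmetric_def sym_def)
  have "\<not> pre_digraph.cycle (with_proj ?G \<restriction> {1..n}) p" for p
  proof
    assume "pre_digraph.cycle (with_proj ?G \<restriction> {1..n}) p"
    hence "p \<noteq> []" "set p \<subseteq> arcs (with_proj ?G \<restriction> {1..n})"
      by (auto simp: pre_digraph.cycle_def pre_digraph.awalk_def)
    thus False by (auto simp: induce_subgraph_def)
  qed
  hence "apex_forest k (with_proj ?G)"
    unfolding apex_forest_def undirected_forest_def by (intro exI[of _ "{}"]) auto
  with g have "?G \<in> apex_forests k n"
    by (auto simp: apex_forests_def labelled_graphs_def)
  thus ?thesis by blast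
qed

lemma eta_least:
  assumes "1 \<le> k"
  shows "0 < eta k" "2 ^ k * eta k = exp (eta k - 1)"
    "\<And>x. 0 < x \<Longrightarrow> 2 ^ k * x = exp (x - 1) \<Longrightarrow> eta k \<le> x"
proof -
  define f where "f x = 2 ^ k * x - exp (x - 1)" for x :: real
  define S where "S = {x \<in> {0..1}. f x = 0}"
  have cont: "continuous_on T f" for T
    unfolding f_def by (intro continuous_intros)
  have f0: "f 0 < 0" by (simp add: f_def)
  have f1: "0 \<le> f 1" by (simp add: f_def)
  have "\<exists>x\<ge>0. x \<le> 1 \<and> f x = 0"
    by (rule IVT') (use f0 f1 cont in auto)
  hence ne: "S \<noteq> {}" by (auto simp: S_def)
  have "closed S"
    unfolding S_def by (rule continuous_closed_preimage_constant[OF cont]) auto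
  moreover have bdd: "bdd_below S" by (auto simp: S_def bdd_below_def)
  ultimately have I: "Inf S \<in> S" using closed_contains_Inf[OF ne] by blast
  have least: "Inf S \<le> x" if "0 < x" "2 ^ k * x = exp (x - 1)" for x
  proof (cases "x \<le> 1")
    case True
    hence "x \<in> S" using that by (auto simp: S_def f_def)
    thus ?thesis using bdd by (rule cInf_lower)
  next
    case False
    thus ?thesis using I by (auto simp: S_def)
  qed
  have sol: "0 < Inf S \<and> 2 ^ k * Inf S = exp (Inf S - 1)"
    using I f0 by (cases "Inf S = 0") (auto simp: S_def f_def)
  have "eta k = Inf S"
    unfolding eta_def by (rule Least_equality) (use sol least in auto)
  thus "0 < eta k" "2 ^ k * eta k = exp (eta k - 1)"
    "\<And>x. 0 < x \<Longrightarrow> 2 ^ k * x = exp (x - 1) \<Longrightarrow> eta k \<le> x"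
    using sol least by auto
qed

end

theory Submission
  imports Defs "HOL-Complex_Analysis.Complex_Analysis"
begin

text \<open>
Write \<open>\<eta>\<close> for the least positive root of \<open>2\<^sup>k \<eta> = e\<^bsup>\<eta> - 1\<^esup>\<close> and put \<open>m = n - k\<close>. A \<open>k\<close>-apex forest consists of
a set \<open>S\<close> of \<open>k\<close> vertices, one of boundedly many graphs on \<open>S\<close>, a forest on the other \<open>m\<close> vertices, and links
between the two sets. If there is no further condition, each vertex of the forest has \<open>2\<^sup>k\<close> possible sets of links. If the
graph is \<open>2\<close>-connected, a vertex that has degree at most one in the forest must be linked to \<open>S\<close>, so
that one choice is lost at each such vertex; for trees this condition almost suffices for
\<open>2\<close>-connectedness. Up to constant factors the probability is therefore the mean of
\<open>(1 - 2\<^bsup>-k\<^esup>)\<^sup>L\<close>, where \<open>L\<close> is the number of leaves of a uniformly random labelled tree on \<open>m\<close> vertices. Four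
facts turn this into a proof.

\<^item> Forests may be replaced by trees (\<open>forest_weight_le_tree_weight\<close>). An edge between two components of
  a forest does not create new vertices of degree at most one, so the weight does not decrease, and a
  double count of such additions shows that forests with \<open>c + 1\<close> components weigh at most
  \<open>2 / c\<close> times as much as those with \<open>c\<close> components. All forests together weigh at most \<open>e\<^sup>2\<close> times as
  much as the trees.

\<^item> Trees are counted by inclusion and exclusion over sets of prescribed leaves
  (\<open>tree_weight_eq\<close>): removing \<open>l\<close> prescribed leaves one at a time leaves a tree on \<open>m - l\<close> vertices, and
  with Cayley's formula there are \<open>(m - l)\<^bsup>m - 2\<^esup>\<close> trees in which the \<open>l\<close> given vertices are leaves. Hence
  the weight of all trees is \<open>\<Sum>l. (m choose l) (-q)\<^sup>l (m - l)\<^bsup>m - 2\<^esup>\<close> with \<open>q = 2\<^bsup>-k\<^esup>\<close>, which is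
  \<open>(m - 2)!\<close> times the coefficient of \<open>x\<^bsup>m - 2\<^esup>\<close> in \<open>(e\<^sup>x - q)\<^sup>m\<close>.

\<^item> The saddle point of this coefficient is the root \<open>r = 1 - \<eta>\<close> of \<open>(1 - r) e\<^sup>r = q\<close>
  (\<open>tree_number_tendsto\<close>). On the circle of radius \<open>r\<close> the integrand becomes the \<open>m\<close>-th power of a
  characteristic function with a Gaussian bound, and dominated convergence gives its order
  \<open>m\<^bsup>-1/2\<^esup>\<close>. The same result with \<open>r = 1\<close>, \<open>q = 0\<close> concerns \<open>m\<^bsup>m - 2\<^esup>\<close> itself, so that in the quotient the factorials
  and the powers of \<open>m\<close> cancel; what remains is \<open>e\<^bsup>- \<eta> m\<^esup>\<close> times a constant.

\<^item> The set \<open>S\<close> can be recovered from a positive proportion of the graphs (\<open>apex_set_unique\<close>), so that the lower bounds lose only a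
  constant factor. All but a negligible number of trees contain a hub, a set of at most \<open>2 (k + 1)\<close> vertices that
  still spans an edge after the removal of any \<open>k\<close> vertices. If every vertex of \<open>S\<close> is
  linked to the whole hub, any other candidate for \<open>S\<close> leaves a triangle behind. Fixing the
  links of boundedly many vertices costs a constant factor, and it also makes the vertices of \<open>S\<close> themselves
  harmless for \<open>2\<close>-connectedness (\<open>biconnected_assemble\<close>).
\<close>

section \<open>Forests as edge sets all of whose edges are bridges\<close>

text \<open>
A simple graph is represented by its set of ordered adjacent pairs, so that reachability is the
reflexive transitive closure. Every undirected edge contributes two pairs; this is the source of the
factors of two in edge counts below.
\<close>

definition simple_on :: "'a set \<Rightarrow> ('a \<times> 'a) set \<Rightarrow> bool" where
  "simple_on V E \<longleftrightarrow> E \<subseteq> V \<times> V \<and> sym E \<and> irrefl E"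

definition both_ways :: "'a \<Rightarrow> 'a \<Rightarrow> ('a \<times> 'a) set" where
  "both_ways u v = {(u, v), (v, u)}"

text \<open>
Acyclicity without cycles: an edge lies on a cycle if and only if its ends remain connected when
it is deleted. This form suits the addition and deletion of single edges.
\<close>

definition bridges_only :: "('a \<times> 'a) set \<Rightarrow> bool" where
  "bridges_only E \<longleftrightarrow> (\<forall>(u, v) \<in> E. (u, v) \<notin> (E - both_ways u v)\<^sup>*)"

definition comps :: "'a set \<Rightarrow> ('a \<times> 'a) set \<Rightarrow> 'a set set" where
  "comps V E = (\<lambda>v. E\<^sup>* `` {v}) ` V"

lemma sym_diff_both_ways: "sym E \<Longrightarrow> sym (E - both_ways u v)"
  by (auto simp: both_ways_def sym_def)

lemma sym_rtrancl_iff: "sym E \<Longrightarrow> (a, b) \<in> E\<^sup>* \<longleftrightarrow> (b, a) \<in> E\<^sup>*"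
  by (meson sym_rtrancl symE)

lemma rtrancl_Un_both_ways:
  assumes "sym E"
  shows "(a, b) \<in> (E \<union> both_ways u v)\<^sup>* \<longleftrightarrow>
    (a, b) \<in> E\<^sup>* \<or> (a, u) \<in> E\<^sup>* \<and> (v, b) \<in> E\<^sup>* \<or> (a, v) \<in> E\<^sup>* \<and> (u, b) \<in> E\<^sup>*"
proof -
  have eq: "E \<union> both_ways u v = insert (u, v) (insert (v, u) E)"
    by (auto simp: both_ways_def)
  note s = sym_rtrancl_iff[OF assms]
  show ?thesis
    unfolding eq rtrancl_insert by (auto intro: rtrancl_trans dest: s[THEN iffD1])
qed

lemma simple_onD:
  assumes "simple_on V E"
  shows "sym E" "irrefl E" "\<And>a b. (a, b) \<in> E \<Longrightarrow> a \<in> V" "\<And>a b. (a, b) \<in> E \<Longrightarrow> b \<in> V"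
    "\<And>a b. (a, b) \<in> E \<Longrightarrow> (b, a) \<in> E" "\<And>a. (a, a) \<notin> E" "E \<subseteq> V \<times> V"
  using assms by (auto simp: simple_on_def sym_def irrefl_def)

lemma simple_on_finite: "simple_on V E \<Longrightarrow> finite V \<Longrightarrow> finite E"
  by (rule finite_subset[of _ "V \<times> V"]) (auto simp: simple_on_def)

lemma finite_simple_on: "finite V \<Longrightarrow> finite {E. simple_on V E \<and> P E}"
  by (rule finite_subset[of _ "Pow (V \<times> V)"]) (auto simp: simple_on_def)

lemma simple_on_Un_both_ways:
  "simple_on V E \<Longrightarrow> u \<in> V \<Longrightarrow> v \<in> V \<Longrightarrow> u \<noteq> v \<Longrightarrow> simple_on V (E \<union> both_ways u v)"
  by (auto simp: simple_on_def both_ways_def sym_def irrefl_def)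

lemma simple_on_Diff_both_ways:
  "simple_on V E \<Longrightarrow> simple_on V (E - both_ways u v)"
  by (auto simp: simple_on_def both_ways_def sym_def irrefl_def)

lemma bridges_only_mono: "bridges_only E \<Longrightarrow> F \<subseteq> E \<Longrightarrow> bridges_only F"
  unfolding bridges_only_def by (blast dest: rtrancl_mono[THEN subsetD, rotated, of _ "F - both_ways _ _" "E - both_ways _ _"])

lemma bridges_onlyD: "bridges_only E \<Longrightarrow> (u, v) \<in> E \<Longrightarrow> (u, v) \<notin> (E - both_ways u v)\<^sup>*"
  by (auto simp: bridges_only_def)

text \<open>
If some old edge \<open>ab\<close> stopped being a bridge, a path around it would use the new edge \<open>uv\<close>, so that
\<open>u\<close> and \<open>v\<close> would have been connected through \<open>ab\<close> before.
\<close>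

lemma bridges_only_Un_both_ways:
  assumes E: "sym E" "bridges_only E" and uv: "(u, v) \<notin> E\<^sup>*"
  shows "bridges_only (E \<union> both_ways u v)"
  unfolding bridges_only_def
proof (intro ballI, clarify)
  fix a b assume ab: "(a, b) \<in> E \<union> both_ways u v"
    and path: "(a, b) \<in> (E \<union> both_ways u v - both_ways a b)\<^sup>*"
  have uvE: "(u, v) \<notin> E" "(v, u) \<notin> E" using uv E(1) by (auto dest: symE)
  show False
  proof (cases "(a, b) \<in> both_ways u v")
    case True
    hence "E \<union> both_ways u v - both_ways a b = E" using uvE by (auto simp: both_ways_def)
    thus False using path True uv sym_rtrancl_iff[OF E(1)] by (auto simp: both_ways_def)
  next
    case False
    hence abE: "(a, b) \<in> E" using ab by auto
    let ?F = "E - both_ways a b"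
    have "E \<union> both_ways u v - both_ways a b \<subseteq> ?F \<union> both_ways u v" by auto
    hence "(a, b) \<in> (?F \<union> both_ways u v)\<^sup>*" using path rtrancl_mono by blast
    moreover have "(a, b) \<notin> ?F\<^sup>*" using bridges_onlyD[OF E(2) abE] .
    ultimately have "(a, u) \<in> ?F\<^sup>* \<and> (v, b) \<in> ?F\<^sup>* \<or> (a, v) \<in> ?F\<^sup>* \<and> (u, b) \<in> ?F\<^sup>*"
      using rtrancl_Un_both_ways[OF sym_diff_both_ways[OF E(1)]] by metis
    moreover have "?F\<^sup>* \<subseteq> E\<^sup>*" by (rule rtrancl_mono) auto
    ultimately have "(a, u) \<in> E\<^sup>* \<and> (v, b) \<in> E\<^sup>* \<or> (a, v) \<in> E\<^sup>* \<and> (u, b) \<in> E\<^sup>*" by blast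
    thus False using uv abE sym_rtrancl_iff[OF E(1)]
      by (metis rtrancl_trans r_into_rtrancl)
  qed
qed

lemma class_eq_iff:
  assumes "sym E"
  shows "E\<^sup>* `` {a} = E\<^sup>* `` {b} \<longleftrightarrow> (a, b) \<in> E\<^sup>*"
  using sym_rtrancl_iff[OF assms] by (auto intro: rtrancl_trans) 

lemma finite_components [simp]: "finite V \<Longrightarrow> finite (comps V E)"
  by (simp add: comps_def)

text \<open>
The new edge merges the classes of its ends and leaves all other classes alone.
\<close>

lemma card_components_Un_both_ways:
  assumes V: "finite V" and E: "sym E" and uv: "u \<in> V" "v \<in> V" "(u, v) \<notin> E\<^sup>*"
  shows "card (comps V E) = Suc (card (comps V (E \<union> both_ways u v)))"
proof -
  let ?A = "E\<^sup>* `` {u}" and ?B = "E\<^sup>* `` {v}" and ?E' = "E \<union> both_ways u v"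
  note s = sym_rtrancl_iff[OF E]
  have cls: "?E'\<^sup>* `` {a} = (if a \<in> ?A \<union> ?B then ?A \<union> ?B else E\<^sup>* `` {a})" for a
  proof -
    have sy: "(y, x) \<in> E\<^sup>*" if "(x, y) \<in> E\<^sup>*" for x y using that s by blast
    have tr: "(x, z) \<in> E\<^sup>*" if "(x, y) \<in> E\<^sup>*" "(y, z) \<in> E\<^sup>*" for x y z
      using that by (rule rtrancl_trans)
    have r: "x \<in> ?E'\<^sup>* `` {a} \<longleftrightarrow> (a, x) \<in> E\<^sup>* \<or> (a, u) \<in> E\<^sup>* \<and> (v, x) \<in> E\<^sup>* \<or>
        (a, v) \<in> E\<^sup>* \<and> (u, x) \<in> E\<^sup>*" for x
      using rtrancl_Un_both_ways[OF E, of a x u v] by blast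
    show ?thesis
    proof (cases "a \<in> ?A \<union> ?B")
      case True
      have "x \<in> ?E'\<^sup>* `` {a} \<longleftrightarrow> x \<in> ?A \<union> ?B" for x
        using r[of x] True sy tr by blast
      thus ?thesis using True by auto
    next
      case False
      have "x \<in> ?E'\<^sup>* `` {a} \<longleftrightarrow> x \<in> E\<^sup>* `` {a}" for x
        using r[of x] False sy by blast
      thus ?thesis using False by auto
    qed
  qed
  have AB: "?A \<noteq> ?B" using class_eq_iff[OF E] uv by auto
  have "comps V ?E' = insert (?A \<union> ?B) (comps V E - {?A, ?B})"
  proof (intro equalityI subsetI)
    fix C assume "C \<in> comps V ?E'"
    then obtain a where a: "a \<in> V" "C = ?E'\<^sup>* `` {a}" by (auto simp: comps_def)
    show "C \<in> insert (?A \<union> ?B) (comps V E - {?A, ?B})"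
    proof (cases "a \<in> ?A \<union> ?B")
      case True thus ?thesis using a cls by simp
    next
      case False
      hence "E\<^sup>* `` {a} \<noteq> ?A" "E\<^sup>* `` {a} \<noteq> ?B" by auto
      thus ?thesis using a cls False by (auto simp: comps_def)
    qed
  next
    fix C assume C: "C \<in> insert (?A \<union> ?B) (comps V E - {?A, ?B})"
    show "C \<in> comps V ?E'"
    proof (cases "C = ?A \<union> ?B")
      case True
      have "?E'\<^sup>* `` {u} = ?A \<union> ?B" using cls[of u] by auto
      thus ?thesis using True uv by (auto simp: comps_def)
    next
      case False
      then obtain a where a: "a \<in> V" "C = E\<^sup>* `` {a}" "C \<noteq> ?A" "C \<noteq> ?B" using C by (auto simp: comps_def)
      hence "a \<notin> ?A \<union> ?B" using class_eq_iff[OF E] s by auto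
      thus ?thesis using a cls[of a] by (auto simp: comps_def)
    qed
  qed
  moreover have "?A \<union> ?B \<notin> comps V E - {?A, ?B}"
  proof
    assume "?A \<union> ?B \<in> comps V E - {?A, ?B}"
    then obtain a where "?A \<union> ?B = E\<^sup>* `` {a}" by (auto simp: comps_def)
    hence "(a, u) \<in> E\<^sup>*" "(a, v) \<in> E\<^sup>*" by auto
    thus False using uv s by (meson rtrancl_trans)
  qed
  moreover have mem: "{?A, ?B} \<subseteq> comps V E" using uv by (auto simp: comps_def)
  moreover have "card {?A, ?B} = 2" using AB by simp
  moreover have "card {?A, ?B} \<le> card (comps V E)"
    using mem V by (intro card_mono) auto
  ultimately show ?thesis using V by (simp add: card_Diff_subset)
qed

text \<open>
Deleting an edge of a forest splits exactly one component; the empty graph has one component for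
each vertex.
\<close>

lemma card_forest_edges:
  assumes V: "finite V" and E: "simple_on V E" "bridges_only E"
  shows "card E + 2 * card (comps V E) = 2 * card V"
  using E
proof (induction "card E" arbitrary: E rule: less_induct)
  case less
  have fin: "finite E" using less.prems V simple_on_finite by blast
  show ?case
  proof (cases "E = {}")
    case True
    have "comps V {} = (\<lambda>v. {v}) ` V" by (auto simp: comps_def)
    hence "card (comps V {}) = card V" by (simp add: card_image inj_on_def)
    thus ?thesis using True by simp
  next
    case False
    then obtain u v where uv: "(u, v) \<in> E" by auto
    note E = simple_onD[OF less.prems(1)]
    have ne: "u \<noteq> v" using uv E(6) by auto
    let ?F = "E - both_ways u v"
    have sub: "both_ways u v \<subseteq> E" using uv E(5) by (auto simp: both_ways_def)
    have c2: "card (both_ways u v) = 2" using ne by (simp add: both_ways_def)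
    have cF: "card ?F + 2 = card E"
      using card_Diff_subset[of "both_ways u v" E] card_mono[OF fin sub] c2 sub
      by (simp add: finite_subset[OF sub fin])
    have EF: "?F \<union> both_ways u v = E" using sub by auto
    have "card (comps V ?F) = Suc (card (comps V E))"
      using card_components_Un_both_ways[OF V sym_diff_both_ways[OF E(1)], of u v u v]
        E(3,4)[OF uv] bridges_onlyD[OF less.prems(2) uv] EF by simp
    moreover have "card ?F + 2 * card (comps V ?F) = 2 * card V"
      using less.hyps[of ?F] cF simple_on_Diff_both_ways[OF less.prems(1)]
        bridges_only_mono[OF less.prems(2)] by auto
    ultimately show ?thesis using cF by simp
  qed
qed

definition labelled_trees :: "'a set \<Rightarrow> ('a \<times> 'a) set set" where
  "labelled_trees V = {E. simple_on V E \<and> bridges_only E \<and> card (comps V E) = 1}"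

lemma treesD:
  assumes "E \<in> labelled_trees V"
  shows "simple_on V E" "bridges_only E" "\<And>a b. a \<in> V \<Longrightarrow> b \<in> V \<Longrightarrow> (a, b) \<in> E\<^sup>*"
proof -
  show E: "simple_on V E" "bridges_only E" using assms by (auto simp: labelled_trees_def)
  fix a b assume ab: "a \<in> V" "b \<in> V"
  have "card (comps V E) = 1" using assms by (auto simp: labelled_trees_def)
  then obtain C where "comps V E = {C}" by (auto simp: card_1_singleton_iff)
  moreover have "E\<^sup>* `` {a} \<in> comps V E" "E\<^sup>* `` {b} \<in> comps V E"
    using ab by (auto simp: comps_def)
  ultimately have "E\<^sup>* `` {a} = E\<^sup>* `` {b}" by simp
  thus "(a, b) \<in> E\<^sup>*" by auto
qed

lemma treesI:
  assumes "simple_on V E" "bridges_only E" "V \<noteq> {}" "\<And>a b. a \<in> V \<Longrightarrow> b \<in> V \<Longrightarrow> (a, b) \<in> E\<^sup>*"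
  shows "E \<in> labelled_trees V"
proof -
  have s: "sym E" using assms simple_onD by metis
  obtain a where a: "a \<in> V" using assms by auto
  have "comps V E = {E\<^sup>* `` {a}}"
    unfolding comps_def using a assms(4) class_eq_iff[OF s] by blast
  thus ?thesis using assms by (auto simp: labelled_trees_def)
qed

lemma finite_trees: "finite V \<Longrightarrow> finite (labelled_trees V)"
  unfolding labelled_trees_def by (rule finite_simple_on)

text \<open>
The leaves together with the isolated vertices: these are the vertices that need a link to the apex set
in a \<open>2\<close>-connected graph.
\<close>

definition low_degree :: "'a set \<Rightarrow> ('a \<times> 'a) set \<Rightarrow> 'a set" where
  "low_degree V E = {v \<in> V. card (E `` {v}) \<le> 1}"

lemma low_subset: "low_degree V E \<subseteq> V"
  by (auto simp: low_degree_def)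

lemma finite_low: "finite V \<Longrightarrow> finite (low_degree V E)"
  by (auto simp: low_degree_def)

lemma low_antimono:
  assumes "E \<subseteq> F" "finite F"
  shows "low_degree V F \<subseteq> low_degree V E"
proof -
  have "card (E `` {v}) \<le> card (F `` {v})" for v
    using assms by (intro card_mono) (auto intro: finite_Image)
  thus ?thesis unfolding low_degree_def using order_trans by fastforce
qed

lemma card_eq_sum_degrees:
  assumes "finite V" "E \<subseteq> V \<times> V"
  shows "card E = (\<Sum>v\<in>V. card (E `` {v}))"
proof -
  have "E = (SIGMA v:V. E `` {v})" using assms by auto
  moreover have "finite E" using assms finite_subset by blast
  hence "\<forall>v\<in>V. finite (E `` {v})" using assms by (auto intro: finite_Image)
  ultimately show ?thesis using assms card_SigmaI by metis
qed

text \<open>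
Otherwise the degree sum would be at least \<open>2 card V\<close>, but a tree has only \<open>2 card V - 2\<close> ordered
adjacent pairs.
\<close>

lemma tree_low_nonempty:
  assumes V: "finite V" "V \<noteq> {}" and T: "T \<in> labelled_trees V"
  shows "low_degree V T \<noteq> {}"
proof
  assume "low_degree V T = {}"
  hence ge: "\<forall>v\<in>V. 2 \<le> card (T `` {v})" by (force simp: low_degree_def)
  have "T \<subseteq> V \<times> V" using treesD(1)[OF T] simple_onD by metis
  hence "card T = (\<Sum>v\<in>V. card (T `` {v}))" using V card_eq_sum_degrees by metis
  also have "\<dots> \<ge> (\<Sum>v\<in>V. 2)" using ge by (intro sum_mono) auto
  finally have "2 * card V \<le> card T" by simp
  moreover have "card T + 2 * card (comps V T) = 2 * card V"
    using card_forest_edges V treesD[OF T] by blast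
  moreover have "card (comps V T) = 1" using T by (auto simp: labelled_trees_def)
  ultimately show False by simp
qed

section \<open>Weighted forests are dominated by weighted trees\<close>

definition labelled_forests :: "'a set \<Rightarrow> ('a \<times> 'a) set set" where
  "labelled_forests V = {E. simple_on V E \<and> bridges_only E}"

lemma finite_forests: "finite V \<Longrightarrow> finite (labelled_forests V)"
  unfolding labelled_forests_def by (rule finite_simple_on)

text \<open>
Each vertex is separated from at least one vertex in each of the \<open>c\<close> other components.
\<close>

lemma card_inequivalent_ge:
  assumes V: "finite V" and E: "simple_on V E" and c: "card (comps V E) = Suc c"
  shows "card V * c \<le> card {(u, v) \<in> V \<times> V. (u, v) \<notin> E\<^sup>*}"
proof -
  have s: "sym E" using E simple_onD by metis
  have each: "c \<le> card {v \<in> V. (u, v) \<notin> E\<^sup>*}" if u: "u \<in> V" for u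
  proof -
    have "comps V E - {E\<^sup>* `` {u}} \<subseteq> (\<lambda>v. E\<^sup>* `` {v}) ` {v \<in> V. (u, v) \<notin> E\<^sup>*}"
      using class_eq_iff[OF s] by (auto simp: comps_def)
    hence "card (comps V E - {E\<^sup>* `` {u}}) \<le> card {v \<in> V. (u, v) \<notin> E\<^sup>*}"
      using V by (intro surj_card_le) auto
    moreover have "E\<^sup>* `` {u} \<in> comps V E" using u by (auto simp: comps_def)
    ultimately show ?thesis using c V by simp
  qed
  have "{(u, v) \<in> V \<times> V. (u, v) \<notin> E\<^sup>*} = (SIGMA u:V. {v \<in> V. (u, v) \<notin> E\<^sup>*})" by auto
  hence "card {(u, v) \<in> V \<times> V. (u, v) \<notin> E\<^sup>*} = (\<Sum>u\<in>V. card {v \<in> V. (u, v) \<notin> E\<^sup>*})"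
    using V by simp
  also have "\<dots> \<ge> (\<Sum>u\<in>V. c)" using each by (intro sum_mono) auto
  finally show ?thesis by simp
qed

definition forest_weight :: "'a set \<Rightarrow> real \<Rightarrow> nat \<Rightarrow> real" where
  "forest_weight V w c = (\<Sum>E\<in>{E \<in> labelled_forests V. card (comps V E) = c}. w ^ card (low_degree V E))"

text \<open>
Double counting of the pairs consisting of a forest with \<open>c + 1\<close> components and an ordered pair of
vertices in different components. There are at least \<open>c card V\<close> such pairs for each forest, whereas each
forest with \<open>c\<close> components arises at most \<open>2 card V\<close> times, once for each ordered edge. Since \<open>w \<le> 1\<close>, joining the
two vertices does not decrease the weight.
\<close>

lemma forest_weight_step:
  fixes w :: real
  assumes V: "finite V" "V \<noteq> {}" and w: "0 \<le> w" "w \<le> 1"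
  shows "c * forest_weight V w (Suc c) \<le> 2 * forest_weight V w c"
proof -
  define F where "F c = {E \<in> labelled_forests V. card (comps V E) = c}" for c
  define N where "N E = {(u, v) \<in> V \<times> V. (u, v) \<notin> E\<^sup>*}" for E
  define wt where "wt E = w ^ card (low_degree V E)" for E
  have finF: "finite (F c)" for c using finite_forests[OF V(1)] by (auto simp: F_def)
  have finN: "finite (N E)" for E
    by (rule finite_subset[of _ "V \<times> V"]) (auto simp: N_def V)
  have wt0: "wt E \<ge> 0" for E using w by (simp add: wt_def)
  have finE: "finite E" if "E \<in> F c" for E c
    using that V simple_on_finite by (auto simp: F_def labelled_forests_def)
  have "card V * c * (\<Sum>E\<in>F (Suc c). wt E) \<le> (\<Sum>E\<in>F (Suc c). card (N E) * wt E)"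
    unfolding sum_distrib_left
  proof (rule sum_mono)
    fix E assume "E \<in> F (Suc c)"
    hence "card V * c \<le> card (N E)"
      unfolding N_def F_def labelled_forests_def by (intro card_inequivalent_ge V) auto
    hence "real (card V * c) \<le> real (card (N E))" by (rule of_nat_mono)
    thus "card V * c * wt E \<le> card (N E) * wt E"
      using wt0 by (intro mult_right_mono) auto
  qed
  also have "\<dots> = (\<Sum>E\<in>F (Suc c). \<Sum>p\<in>N E. wt E)" by simp
  also have "\<dots> = (\<Sum>(E, p)\<in>Sigma (F (Suc c)) N. wt E)"
    using finF finN by (subst sum.Sigma) auto
  also have "\<dots> \<le> (\<Sum>(E, p)\<in>Sigma (F c) (\<lambda>E. E). wt E)"
  proof -
    define g where "g = (\<lambda>(E, u, v). (E \<union> both_ways u v, u, v :: 'a))"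
    have inj: "inj_on g (Sigma (F (Suc c)) N)"
    proof (rule inj_onI)
      fix p p' assume p: "p \<in> Sigma (F (Suc c)) N" "p' \<in> Sigma (F (Suc c)) N" "g p = g p'"
      obtain E u v E' u' v' where pp: "p = (E, u, v)" "p' = (E', u', v')" by (cases p, cases p')
      have a: "E \<in> F (Suc c)" "(u, v) \<in> N E" "E' \<in> F (Suc c)" "(u', v') \<in> N E'"
        and eq: "g (E, u, v) = g (E', u', v')" using p pp by auto
      have "both_ways u v \<inter> E = {}" "both_ways u' v' \<inter> E' = {}"
        using a simple_onD(5)[of V E v u] simple_onD(5)[of V E' v' u']
        by (auto simp: F_def labelled_forests_def N_def both_ways_def)
      thus "p = p'" using eq pp by (auto simp: g_def)
    qed
    have img: "g ` Sigma (F (Suc c)) N \<subseteq> Sigma (F c) (\<lambda>E. E)"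
    proof
      fix q assume "q \<in> g ` Sigma (F (Suc c)) N"
      then obtain E u v where q: "q = g (E, u, v)" and a: "E \<in> F (Suc c)" "(u, v) \<in> N E"
        by auto
      have E: "simple_on V E" "bridges_only E" "card (comps V E) = Suc c"
        and uv: "u \<in> V" "v \<in> V" "(u, v) \<notin> E\<^sup>*" "u \<noteq> v"
        using a by (auto simp: F_def labelled_forests_def N_def)
      have s: "sym E" using E simple_onD by metis
      have "E \<union> both_ways u v \<in> F c"
        using simple_on_Un_both_ways[OF E(1) uv(1,2,4)] bridges_only_Un_both_ways[OF s E(2) uv(3)]
          card_components_Un_both_ways[OF V(1) s uv(1-3)] E(3) by (auto simp: F_def labelled_forests_def)
      thus "q \<in> Sigma (F c) (\<lambda>E. E)" using q by (auto simp: g_def both_ways_def)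
    qed
    have "(\<Sum>(E, p)\<in>Sigma (F (Suc c)) N. wt E) \<le> (\<Sum>x\<in>Sigma (F (Suc c)) N. wt (fst (g x)))"
    proof (rule sum_mono)
      fix q assume "q \<in> Sigma (F (Suc c)) N"
      then obtain E u v where q: "q = (E, u, v)" and a: "E \<in> F (Suc c)" "(u, v) \<in> N E"
        by auto
      have "low_degree V (E \<union> both_ways u v) \<subseteq> low_degree V E"
        using finE[OF a(1)] by (intro low_antimono) (auto simp: both_ways_def)
      hence "card (low_degree V (E \<union> both_ways u v)) \<le> card (low_degree V E)"
        using finite_low V by (intro card_mono) auto
      hence "wt E \<le> wt (fst (g (E, u, v)))"
        unfolding wt_def g_def using w by (simp add: power_decreasing)
      thus "(case q of (E, p) \<Rightarrow> wt E) \<le> wt (fst (g q))" using q by simp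
    qed
    also have "\<dots> = (\<Sum>x\<in>g ` Sigma (F (Suc c)) N. wt (fst x))"
      using inj by (subst sum.reindex) auto
    also have "\<dots> \<le> (\<Sum>x\<in>Sigma (F c) (\<lambda>E. E). wt (fst x))"
      using img wt0 finF finE by (intro sum_mono2) auto
    finally show ?thesis by (simp add: case_prod_unfold)
  qed
  also have "\<dots> = (\<Sum>E\<in>F c. card E * wt E)"
    using finF finE by (subst sum.Sigma[symmetric]) auto
  also have "\<dots> \<le> (\<Sum>E\<in>F c. 2 * card V * wt E)"
  proof (rule sum_mono)
    fix E assume "E \<in> F c"
    hence "card E + 2 * card (comps V E) = 2 * card V"
      by (intro card_forest_edges V) (auto simp: F_def labelled_forests_def)
    hence "real (card E) \<le> 2 * card V" by linarith
    thus "card E * wt E \<le> 2 * card V * wt E" using wt0 by (intro mult_right_mono) auto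
  qed
  finally have "card V * (c * (\<Sum>E\<in>F (Suc c). wt E)) \<le> card V * (2 * (\<Sum>E\<in>F c. wt E))"
    by (simp add: sum_distrib_left mult_ac)
  moreover have "card V > 0" using V by (simp add: card_gt_0_iff)
  ultimately have "c * (\<Sum>E\<in>F (Suc c). wt E) \<le> 2 * (\<Sum>E\<in>F c. wt E)"
    by (simp only: mult_le_cancel_left_pos of_nat_0_less_iff)
  thus ?thesis by (simp add: forest_weight_def F_def wt_def)
qed

definition tree_weight :: "'a set \<Rightarrow> real \<Rightarrow> real" where
  "tree_weight V w = (\<Sum>T\<in>labelled_trees V. w ^ card (low_degree V T))"

text \<open>
By \<open>forest_weight_step\<close> the forests with \<open>c + 1\<close> components weigh at most \<open>2\<^sup>c / c!\<close> times as much as the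
trees, and these factors sum to at most \<open>e\<^sup>2\<close>.
\<close>

lemma forest_weight_le_tree_weight:
  fixes w :: real
  assumes V: "finite V" "V \<noteq> {}" and w: "0 \<le> w" "w \<le> 1"
  shows "(\<Sum>E\<in>labelled_forests V. w ^ card (low_degree V E)) \<le> exp 2 * tree_weight V w"
proof -
  have one: "forest_weight V w 1 = tree_weight V w"
    unfolding forest_weight_def tree_weight_def labelled_trees_def labelled_forests_def
    by (rule sum.cong) auto
  have fw: "forest_weight V w (Suc c) \<le> 2 ^ c / fact c * tree_weight V w" for c
  proof (induction c)
    case 0 thus ?case using one by simp
  next
    case (Suc c)
    have "real (Suc c) * forest_weight V w (Suc (Suc c)) \<le> 2 * forest_weight V w (Suc c)"
      by (rule forest_weight_step[OF V w])
    also have "\<dots> \<le> 2 * (2 ^ c / fact c * tree_weight V w)" using Suc.IH by simp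
    finally have "forest_weight V w (Suc (Suc c)) \<le> 2 * (2 ^ c / fact c * tree_weight V w) / Suc c"
      by (metis mult.commute of_nat_0_less_iff pos_le_divide_eq zero_less_Suc)
    thus ?case by (simp add: mult_ac)
  qed
  define n where "n = card V"
  have "labelled_forests V = (\<Union>c<n. {E \<in> labelled_forests V. card (comps V E) = Suc c})"
  proof -
    have "\<exists>c<n. card (comps V E) = Suc c" for E
    proof -
      have "comps V E \<noteq> {}" using V by (auto simp: comps_def)
      hence "card (comps V E) > 0" using V by (simp add: card_gt_0_iff)
      moreover have "card (comps V E) \<le> n"
        unfolding comps_def n_def using V by (intro card_image_le) auto
      ultimately show ?thesis by (intro exI[of _ "card (comps V E) - 1"]) auto
    qed
    thus ?thesis by blast
  qed
  hence "(\<Sum>E\<in>labelled_forests V. w ^ card (low_degree V E)) =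
      (\<Sum>E\<in>(\<Union>c<n. {E \<in> labelled_forests V. card (comps V E) = Suc c}). w ^ card (low_degree V E))" by simp
  also have "\<dots> = (\<Sum>c<n. forest_weight V w (Suc c))"
    unfolding forest_weight_def using finite_forests[OF V(1)]
    by (subst sum.UNION_disjoint) auto
  also have "\<dots> \<le> (\<Sum>c<n. 2 ^ c / fact c * tree_weight V w)" by (intro sum_mono fw)
  also have "\<dots> = (\<Sum>c<n. 2 ^ c /\<^sub>R fact c) * tree_weight V w"
    unfolding sum_distrib_right by (intro sum.cong) (auto simp: divide_inverse)
  also have "\<dots> \<le> exp 2 * tree_weight V w"
  proof (rule mult_right_mono)
    show "(\<Sum>c<n. 2 ^ c /\<^sub>R fact c) \<le> exp (2::real)"
      using sum_le_suminf[OF summable_exp_generic[of "2::real"], of "{..<n}"]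
      by (simp add: exp_def)
    show "0 \<le> tree_weight V w" using w by (auto simp: tree_weight_def intro: sum_nonneg)
  qed
  finally show ?thesis .
qed

section \<open>Labelled trees counted by their leaves\<close>

lemma rtrancl_isolated:
  assumes "sym F" "F `` {x} = {}" "(a, x) \<in> F\<^sup>*"
  shows "a = x"
proof -
  have "(x, a) \<in> F\<^sup>*" using assms sym_rtrancl_iff by metis
  thus ?thesis using assms(2) by (cases rule: converse_rtranclE) auto
qed

lemma trees_insert:
  assumes T: "T \<in> labelled_trees V" and x: "x \<notin> V" and y: "y \<in> V"
  shows "T \<union> both_ways x y \<in> labelled_trees (insert x V)"
proof (rule treesI)
  note t = treesD[OF T] and s = simple_onD[OF treesD(1)[OF T]]
  have "T `` {x} = {}" using s(3) x by auto
  hence xy: "(x, y) \<notin> T\<^sup>*" using rtrancl_isolated[OF s(1), of x y] sym_rtrancl_iff[OF s(1)] x y by metis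
  show "simple_on (insert x V) (T \<union> both_ways x y)"
    using t(1) x y by (auto simp: simple_on_def both_ways_def sym_def irrefl_def)
  show "bridges_only (T \<union> both_ways x y)" by (rule bridges_only_Un_both_ways[OF s(1) t(2) xy])
  show "insert x V \<noteq> {}" by simp
  fix a b assume "a \<in> insert x V" "b \<in> insert x V"
  thus "(a, b) \<in> (T \<union> both_ways x y)\<^sup>*"
    unfolding rtrancl_Un_both_ways[OF s(1)] using t(3) y by auto
qed

text \<open>
A vertex of degree one is never an inner vertex of a path.
\<close>

lemma rtrancl_remove_leaf:
  assumes E: "sym E" "E `` {x} \<subseteq> {y}" and ab: "(a, b) \<in> E\<^sup>*" "a \<noteq> x" "b \<noteq> x"
  shows "(a, b) \<in> (E - both_ways x y)\<^sup>*"
proof -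
  let ?F = "E - both_ways x y"
  have sF: "sym ?F" by (rule sym_diff_both_ways[OF E(1)])
  have iso: "?F `` {x} = {}" using E(2) by (auto simp: both_ways_def)
  have "(a, b) \<in> (?F \<union> both_ways x y)\<^sup>*"
    using ab(1) rtrancl_mono[of E "?F \<union> both_ways x y"] by auto
  thus ?thesis
    unfolding rtrancl_Un_both_ways[OF sF]
    using rtrancl_isolated[OF sF iso] sym_rtrancl_iff[OF sF] ab by metis
qed

lemma trees_remove_leaf:
  assumes T: "T \<in> labelled_trees V" and x: "T `` {x} = {y}"
  shows "T - both_ways x y \<in> labelled_trees (V - {x})"
proof (rule treesI)
  note t = treesD[OF T] and s = simple_onD[OF treesD(1)[OF T]]
  have xy: "(x, y) \<in> T" using x by auto
  show "V - {x} \<noteq> {}" using s(4)[OF xy] s(6) xy by auto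
  have "T - both_ways x y \<subseteq> (V - {x}) \<times> (V - {x})"
  proof (rule subrelI)
    fix a b assume "(a, b) \<in> T - both_ways x y"
    hence ab: "(a, b) \<in> T" "(a, b) \<notin> both_ways x y" by auto
    have "a \<noteq> x" "b \<noteq> x" using ab x s(5)[OF ab(1)] by (auto simp: both_ways_def)
    thus "(a, b) \<in> (V - {x}) \<times> (V - {x})" using s(3,4)[OF ab(1)] by auto
  qed
  thus "simple_on (V - {x}) (T - both_ways x y)"
    using t(1) by (auto simp: simple_on_def both_ways_def sym_def irrefl_def)
  show "bridges_only (T - both_ways x y)" by (rule bridges_only_mono[OF t(2)]) auto
  fix a b assume "a \<in> V - {x}" "b \<in> V - {x}"
  thus "(a, b) \<in> (T - both_ways x y)\<^sup>*"
    using rtrancl_remove_leaf[OF s(1)] x t(3) by auto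
qed

lemma low_tree_neighbour:
  assumes V: "finite V" "2 \<le> card V" and T: "T \<in> labelled_trees V" and x: "x \<in> low_degree V T"
  obtains y where "y \<in> V" "y \<noteq> x" "T `` {x} = {y}"
proof -
  note s = simple_onD[OF treesD(1)[OF T]]
  have xV: "x \<in> V" using x by (auto simp: low_degree_def)
  obtain z where z: "z \<in> V" "z \<noteq> x"
    using V xV by (metis card_1_singleton_iff is_singletonI' is_singleton_altdef not_numeral_le_zero
        card.empty empty_iff numeral_le_one_iff semiring_norm(69))
  have "(x, z) \<in> T\<^sup>*" by (rule treesD(3)[OF T xV z(1)])
  hence ne: "T `` {x} \<noteq> {}" using z(2) by (cases rule: converse_rtranclE) auto
  have "finite T" using simple_on_finite[OF treesD(1)[OF T] V(1)] .
  hence "finite (T `` {x})" by (rule finite_Image)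
  hence "card (T `` {x}) = 1" using x ne by (auto simp: low_degree_def le_Suc_eq)
  then obtain y where y: "T `` {x} = {y}" by (auto simp: card_1_singleton_iff)
  hence "(x, y) \<in> T" by auto
  thus thesis using that[OF _ _ y] s(4,6) by metis
qed

text \<open>
Two adjacent leaves form a component of their own.
\<close>

lemma adjacent_low:
  assumes V: "finite V" "2 \<le> card V" and T: "T \<in> labelled_trees V"
    and xy: "x \<in> low_degree V T" "y \<in> low_degree V T" "(x, y) \<in> T"
  shows "V = {x, y}"
proof -
  note s = simple_onD[OF treesD(1)[OF T]]
  obtain y' where y': "T `` {x} = {y'}" using low_tree_neighbour[OF V T xy(1)] by metis
  obtain x' where x': "T `` {y} = {x'}" using low_tree_neighbour[OF V T xy(2)] by metis
  have yx: "(y, x) \<in> T" using s(5) xy by auto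
  have "z \<in> {x, y}" if "(x, z) \<in> T\<^sup>*" for z
    using that
  proof induction
    case (step z w)
    have "T `` {x} = {y}" "T `` {y} = {x}" using x' y' xy(3) yx
      by (metis Image_singleton_iff singletonD)+
    thus ?case using step(2,3) by blast
  qed simp
  thus ?thesis using treesD(3)[OF T, of x] s(3,4)[OF xy(3)] by auto
qed

text \<open>
Deleting the prescribed leaf \<open>x\<close> is a bijection onto pairs of a smaller tree and an attachment vertex.
The attachment vertex is not in \<open>L\<close>, since a vertex of \<open>L\<close> that carried \<open>x\<close> would have \<open>x\<close> as its only neighbour. The
condition that \<open>insert x L\<close> is not all of \<open>V\<close> excludes the single edge, whose two ends are both leaves.
\<close>

lemma card_trees_low_insert:
  assumes V: "finite V" and L: "insert x L \<subseteq> V" "insert x L \<noteq> V" "x \<notin> L"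
  shows "card {T \<in> labelled_trees V. insert x L \<subseteq> low_degree V T} =
    card {T \<in> labelled_trees (V - {x}). L \<subseteq> low_degree (V - {x}) T} * (card V - card (insert x L))"
proof -
  let ?A = "{T \<in> labelled_trees (V - {x}). L \<subseteq> low_degree (V - {x}) T} \<times> (V - insert x L)"
  let ?B = "{T \<in> labelled_trees V. insert x L \<subseteq> low_degree V T}"
  \<comment> \<open>The inverse bijection: a leaf \<open>x\<close> is attached to the vertex \<open>y\<close>.\<close>
  let ?g = "\<lambda>(T, y). T \<union> both_ways x y"
  have ins: "insert x (V - {x}) = V" using L by auto
  obtain z where z: "z \<in> V" "z \<notin> insert x L" using L by auto
  have "card {x, z} \<le> card V" using V L z by (intro card_mono) auto
  hence V2: "2 \<le> card V" using z by auto
  have no: "a \<noteq> x \<and> b \<noteq> x" if "T \<in> labelled_trees (V - {x})" "(a, b) \<in> T" for T a b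
    using simple_onD(3,4)[OF treesD(1)[OF that(1)] that(2)] by auto
  have "bij_betw ?g ?A ?B"
  proof (rule bij_betw_imageI)
    show "inj_on ?g ?A"
    proof (rule inj_onI)
      fix p p' assume p: "p \<in> ?A" "p' \<in> ?A" "?g p = ?g p'"
      obtain T y T' y' where pp: "p = (T, y)" "p' = (T', y')" by (cases p, cases p')
      have a: "T \<in> labelled_trees (V - {x})" "T' \<in> labelled_trees (V - {x})"
          "y \<notin> insert x L" "y' \<notin> insert x L"
        and eq: "T \<union> both_ways x y = T' \<union> both_ways x y'"
        using p pp by auto
      have "T = {p \<in> T \<union> both_ways x y. fst p \<noteq> x \<and> snd p \<noteq> x}"
        by (auto simp: both_ways_def dest: no[OF a(1)])
      moreover have "T' = {p \<in> T' \<union> both_ways x y'. fst p \<noteq> x \<and> snd p \<noteq> x}"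
        by (auto simp: both_ways_def dest: no[OF a(2)])
      moreover have "{y} = (T \<union> both_ways x y) `` {x}"
        using no[OF a(1)] a(3) by (auto simp: both_ways_def)
      moreover have "{y'} = (T' \<union> both_ways x y') `` {x}"
        using no[OF a(2)] a(4) by (auto simp: both_ways_def)
      ultimately show "p = p'" using eq pp by auto
    qed
    show "?g ` ?A = ?B"
    proof (intro equalityI subsetI)
      fix S assume "S \<in> ?g ` ?A"
      then obtain T y where T: "T \<in> labelled_trees (V - {x})" "L \<subseteq> low_degree (V - {x}) T"
        and y: "y \<in> V" "y \<notin> insert x L" and S: "S = T \<union> both_ways x y" by auto
      have "S \<in> labelled_trees V" using trees_insert[OF T(1), of x y] y ins S by auto
      moreover have "insert x L \<subseteq> low_degree V S"
      proof
        fix l assume l: "l \<in> insert x L"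
        have "S `` {l} \<subseteq> (if l = x then {y} else T `` {l})"
          using no[OF T(1)] l y S by (auto simp: both_ways_def)
        moreover have "finite (T `` {l})"
          using simple_on_finite[OF treesD(1)[OF T(1)]] V by (auto intro: finite_Image)
        ultimately have "card (S `` {l}) \<le> card (if l = x then {y} else T `` {l})"
          by (intro card_mono) auto
        moreover have "l \<noteq> x \<Longrightarrow> card (T `` {l}) \<le> 1" using T(2) l by (auto simp: low_degree_def)
        ultimately show "l \<in> low_degree V S" using L(1) l by (auto simp: low_degree_def split: if_splits)
      qed
      ultimately show "S \<in> ?B" by simp
    next
      fix S assume "S \<in> ?B"
      hence S: "S \<in> labelled_trees V" "insert x L \<subseteq> low_degree V S" by auto
      obtain y where y: "y \<in> V" "y \<noteq> x" "S `` {x} = {y}"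
        using low_tree_neighbour[OF V V2 S(1)] S(2) by blast
      hence xy: "(x, y) \<in> S" by auto
      have "y \<notin> L"
        using adjacent_low[OF V V2 S(1) _ _ xy] S(2) L by auto
      moreover have "S - both_ways x y \<in> labelled_trees (V - {x})" by (rule trees_remove_leaf[OF S(1) y(3)])
      moreover have "L \<subseteq> low_degree (V - {x}) (S - both_ways x y)"
      proof -
        have "finite S" using simple_on_finite[OF treesD(1)[OF S(1)] V] .
        hence "low_degree V S \<subseteq> low_degree V (S - both_ways x y)" by (intro low_antimono) auto
        hence "L \<subseteq> low_degree V (S - both_ways x y)" using S(2) by auto
        thus ?thesis using L by (auto simp: low_degree_def)
      qed
      moreover have "S = (S - both_ways x y) \<union> both_ways x y"
        using xy simple_onD(5)[OF treesD(1)[OF S(1)] xy] by (auto simp: both_ways_def)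
      ultimately show "S \<in> ?g ` ?A" using y
        by (intro image_eqI[of _ _ "(S - both_ways x y, y)"]) auto
    qed
  qed
  hence "card ?A = card ?B" by (rule bij_betw_same_card)
  moreover have "card (V - insert x L) = card V - card (insert x L)"
    using L V by (intro card_Diff_subset) (auto intro: finite_subset)
  ultimately show ?thesis by (simp add: card_cartesian_product)
qed

text \<open>
The prescribed leaves can be attached independently to the vertices outside \<open>L\<close>, because no
prescribed leaf carries another one.
\<close>

lemma card_trees_low:
  assumes "finite V" "L \<subseteq> V" "L \<noteq> V"
  shows "card {T \<in> labelled_trees V. L \<subseteq> low_degree V T} = (card V - card L) ^ card L * card (labelled_trees (V - L))"
proof -
  have "finite L" using assms finite_subset by blast
  thus ?thesis using assms
  proof (induction L arbitrary: V rule: finite_induct)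
    case empty thus ?case by simp
  next
    case (insert x L)
    have "L \<subseteq> V - {x}" "L \<noteq> V - {x}" using insert.prems insert.hyps by auto
    hence "card {T \<in> labelled_trees (V - {x}). L \<subseteq> low_degree (V - {x}) T} =
      (card (V - {x}) - card L) ^ card L * card (labelled_trees (V - {x} - L))"
      using insert by blast
    moreover have "card (V - {x}) - card L = card V - card (insert x L)"
      using insert by simp
    moreover have "V - {x} - L = V - insert x L" by auto
    ultimately show ?case
      unfolding card_trees_low_insert[OF insert.prems(1-3) insert.hyps(2)] using insert.hyps
      by simp
  qed
qed

lemma no_tree_all_low:
  assumes V: "finite V" "3 \<le> card V" and T: "T \<in> labelled_trees V"
  shows "\<not> V \<subseteq> low_degree V T"
proof
  assume all: "V \<subseteq> low_degree V T"
  have V2: "2 \<le> card V" using V by simp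
  obtain x where x: "x \<in> V" using V by fastforce
  then obtain y where y: "y \<in> V" "y \<noteq> x" "T `` {x} = {y}"
    using low_tree_neighbour[OF V(1) V2 T] all by blast
  have "V = {x, y}" using adjacent_low[OF V(1) V2 T, of x y] x y all by auto
  thus False using V y by (simp add: card_insert_if split: if_splits)
qed

lemma sum_Pow_power_card:
  fixes c :: real
  assumes "finite A"
  shows "(\<Sum>L\<in>Pow A. c ^ card L) = (1 + c) ^ card A"
proof -
  have "(\<Prod>i\<in>A. c + 1) = (\<Sum>L\<in>Pow A. (\<Prod>i\<in>L. c) * (\<Prod>i\<in>A - L. 1))"
    by (rule prod_add[OF assms])
  thus ?thesis by (simp add: add.commute)
qed

lemma tree_weight_inclusion_exclusion:
  fixes q :: real
  assumes V: "finite V"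
  shows "tree_weight V (1 - q) = (\<Sum>L\<in>Pow V. (- q) ^ card L * card {T \<in> labelled_trees V. L \<subseteq> low_degree V T})"
proof -
  have "tree_weight V (1 - q) = (\<Sum>T\<in>labelled_trees V. \<Sum>L\<in>Pow (low_degree V T). (- q) ^ card L)"
    unfolding tree_weight_def using sum_Pow_power_card[OF finite_low[OF V], of "- q"] by simp
  also have "\<dots> = (\<Sum>T\<in>labelled_trees V. \<Sum>L\<in>{L \<in> Pow V. L \<subseteq> low_degree V T}. (- q) ^ card L)"
    using low_subset by (intro sum.cong) fastforce+
  also have "\<dots> = (\<Sum>L\<in>Pow V. \<Sum>T\<in>{T \<in> labelled_trees V. L \<subseteq> low_degree V T}. (- q) ^ card L)"
    using V finite_trees by (intro sum.swap_restrict) auto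
  finally show ?thesis by (simp add: mult.commute)
qed

text \<open>
The sum counts maps from a set with \<open>p\<close> elements to \<open>V\<close> with the signed sum over all sets \<open>L\<close> of missed
values; it picks out the surjections, and there are none.
\<close>

lemma sum_Pow_alternating_power:
  assumes V: "finite V" and p: "p < card V"
  shows "(\<Sum>L\<in>Pow V. (- 1) ^ card L * real ((card V - card L) ^ p)) = 0"
proof -
  let ?F = "{..<p} \<rightarrow>\<^sub>E V"
  have fin: "finite ?F" using V by (intro finite_PiE) auto
  have "(\<Sum>L\<in>Pow V. (- 1) ^ card L * real ((card V - card L) ^ p)) =
      (\<Sum>L\<in>Pow V. \<Sum>f\<in>{f \<in> ?F. L \<subseteq> V - f ` {..<p}}. (- 1) ^ card L)"
  proof (rule sum.cong)
    fix L assume L: "L \<in> Pow V"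
    have "{f \<in> ?F. L \<subseteq> V - f ` {..<p}} = {..<p} \<rightarrow>\<^sub>E (V - L)"
      using L by (auto simp: PiE_def Pi_def)
    moreover have "card (V - L) = card V - card L"
      using L V by (intro card_Diff_subset) (auto intro: finite_subset)
    ultimately have "card {f \<in> ?F. L \<subseteq> V - f ` {..<p}} = (card V - card L) ^ p"
      by (simp add: card_PiE)
    thus "(- 1) ^ card L * real ((card V - card L) ^ p) =
        (\<Sum>f\<in>{f \<in> ?F. L \<subseteq> V - f ` {..<p}}. (- 1) ^ card L)" by simp
  qed simp
  also have "\<dots> = (\<Sum>f\<in>?F. \<Sum>L\<in>{L \<in> Pow V. L \<subseteq> V - f ` {..<p}}. (- 1) ^ card L)"
    using fin V by (intro sum.swap_restrict) auto
  also have "\<dots> = (\<Sum>f\<in>?F. \<Sum>L\<in>Pow (V - f ` {..<p}). (- 1) ^ card L)"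
    by (intro sum.cong) auto
  also have "\<dots> = (\<Sum>f\<in>?F. (1 + - 1) ^ card (V - f ` {..<p}))"
    using V by (intro sum.cong sum_Pow_power_card) auto
  also have "\<dots> = 0"
  proof (intro sum.neutral ballI)
    fix f assume "f \<in> ?F"
    have "card (f ` {..<p}) \<le> p" using card_image_le[of "{..<p}" f] by simp
    hence "\<not> V \<subseteq> f ` {..<p}" using p V card_mono[of "f ` {..<p}" V] by auto
    hence "card (V - f ` {..<p}) \<noteq> 0" using V by auto
    thus "(1 + - 1 :: real) ^ card (V - f ` {..<p}) = 0" by simp
  qed
  finally show ?thesis .
qed

lemma trees_singleton: "labelled_trees {v} = {{}}"
proof -
  have "{} \<in> labelled_trees {v}"
    by (auto simp: labelled_trees_def simple_on_def bridges_only_def sym_def irrefl_def comps_def)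
  moreover have "T = {}" if "T \<in> labelled_trees {v}" for T
    using simple_onD(6,7)[OF treesD(1)[OF that]] by auto
  ultimately show ?thesis by auto
qed

text \<open>
Cayley's formula. Every tree has a leaf, so the signed sum over all sets of prescribed leaves, including the
empty set, vanishes. By induction the term of a nonempty set of \<open>l\<close> leaves is
\<open>(m - l)\<^bsup>l\<^esup> (m - l)\<^bsup>m - l - 2\<^esup> = (m - l)\<^bsup>m - 2\<^esup>\<close>, and the sum of all these signed powers, with the term
\<open>m\<^bsup>m - 2\<^esup>\<close> for the empty set, vanishes as well.
\<close>

lemma card_trees:
  assumes "finite V" "V \<noteq> {}"
  shows "card (labelled_trees V) = card V ^ (card V - 2)"
  using assms
proof (induction "card V" arbitrary: V rule: less_induct)
  case less
  note V = less.prems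
  consider "card V = 1" | "card V = 2" | "3 \<le> card V" using V card_gt_0_iff[of V] by linarith
  thus ?case
  proof cases
    case 1
    then obtain v where "V = {v}" by (auto simp: card_1_singleton_iff)
    thus ?thesis by (simp add: trees_singleton)
  next
    case 2
    then obtain x y where xy: "V = {x, y}" "x \<noteq> y" by (auto simp: card_2_iff)
    have "{T \<in> labelled_trees V. {x} \<subseteq> low_degree V T} = labelled_trees V"
    proof -
      have "x \<in> low_degree V T" if "T \<in> labelled_trees V" for T
      proof -
        have "T `` {x} \<subseteq> {y}" using simple_onD(4,6)[OF treesD(1)[OF that]] xy by auto
        hence "card (T `` {x}) \<le> card {y}" by (intro card_mono) auto
        thus ?thesis using xy by (simp add: low_degree_def)
      qed
      thus ?thesis by auto
    qed
    moreover have "V - {x} = {y}" using xy by auto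
    ultimately show ?thesis using card_trees_low[OF V(1), of "{x}"] xy by (simp add: trees_singleton)
  next
    case 3
    have eq: "card {T \<in> labelled_trees V. L \<subseteq> low_degree V T} = (card V - card L) ^ (card V - 2)"
      if L: "L \<subseteq> V" "L \<noteq> {}" for L
    proof (cases "L = V")
      case True
      have "{T \<in> labelled_trees V. L \<subseteq> low_degree V T} = {}" using no_tree_all_low[OF V(1) 3] True by auto
      thus ?thesis using 3 True by (simp only: card.empty) simp
    next
      case False
      have fL: "finite L" using L V finite_subset by blast
      have cd: "card (V - L) = card V - card L" using card_Diff_subset[OF fL L(1)] .
      have "card L > 0" using fL L by (simp add: card_gt_0_iff)
      moreover have "card L < card V" using L False V psubset_card_mono by blast
      ultimately have lt: "card (V - L) < card V" and pos: "card (V - L) > 0" using cd by auto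
      have "card (labelled_trees (V - L)) = (card V - card L) ^ (card V - card L - 2)"
        using less.hyps[OF lt] V pos cd by (metis card.empty finite_Diff less_nat_zero_code)
      hence *: "card {T \<in> labelled_trees V. L \<subseteq> low_degree V T} =
          (card V - card L) ^ (card L + (card V - card L - 2))"
        using card_trees_low[OF V(1) L(1) False] by (simp add: power_add)
      show ?thesis
      proof (cases "card V - card L = 1")
        case True thus ?thesis using * by simp
      next
        case False
        hence "card L + (card V - card L - 2) = card V - 2" using pos cd by auto
        thus ?thesis using * by simp
      qed
    qed
    have "0 = tree_weight V (1 - 1)"
      unfolding tree_weight_def using tree_low_nonempty[OF V] finite_low[OF V(1)]
      by (intro sum.neutral[symmetric]) (simp add: card_gt_0_iff)
    also have "\<dots> = (\<Sum>L\<in>Pow V. (- 1 :: real) ^ card L * card {T \<in> labelled_trees V. L \<subseteq> low_degree V T})"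
      using tree_weight_inclusion_exclusion[OF V(1), of 1] by simp
    also have "\<dots> = card (labelled_trees V) + (\<Sum>L\<in>Pow V - {{}}. (- 1 :: real) ^ card L * card {T \<in> labelled_trees V. L \<subseteq> low_degree V T})"
      using V by (subst sum.remove[of _ "{}"]) auto
    also have "(\<Sum>L\<in>Pow V - {{}}. (- 1 :: real) ^ card L * card {T \<in> labelled_trees V. L \<subseteq> low_degree V T}) =
        (\<Sum>L\<in>Pow V - {{}}. (- 1) ^ card L * real ((card V - card L) ^ (card V - 2)))"
      using eq by (intro sum.cong) auto
    also have "\<dots> = (\<Sum>L\<in>Pow V. (- 1) ^ card L * real ((card V - card L) ^ (card V - 2))) -
        card V ^ (card V - 2)"
      using V by (subst sum.remove[of _ "{}"]) auto
    also have "(\<Sum>L\<in>Pow V. (- 1) ^ card L * real ((card V - card L) ^ (card V - 2))) = 0"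
      using 3 by (intro sum_Pow_alternating_power V) auto
    finally show ?thesis by (simp flip: of_nat_power)
  qed
qed

text \<open>
For \<open>m \<ge> 2\<close> this is the coefficient of \<open>x\<^bsup>m - 2\<^esup>\<close> in \<open>(e\<^sup>x - q)\<^sup>m\<close>, multiplied by \<open>(m - 2)!\<close>.
\<close>

definition tree_number :: "nat \<Rightarrow> real \<Rightarrow> real" where
  "tree_number m q = (\<Sum>l\<le>m. real (m choose l) * (- q) ^ l * real (m - l) ^ (m - 2))"

lemma sum_Pow_card:
  fixes f :: "nat \<Rightarrow> real"
  assumes "finite A"
  shows "(\<Sum>L\<in>Pow A. f (card L)) = (\<Sum>l\<le>card A. (card A choose l) * f l)"
proof -
  have "(\<Sum>L\<in>Pow A. f (card L)) = (\<Sum>l\<le>card A. \<Sum>L\<in>{L \<in> Pow A. card L = l}. f (card L))"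
    using assms by (intro sum.group[symmetric]) (auto intro: card_mono)
  also have "\<dots> = (\<Sum>l\<le>card A. (card A choose l) * f l)"
    using n_subsets[OF assms] by (intro sum.cong) auto
  finally show ?thesis .
qed

text \<open>
Inclusion and exclusion for the weight \<open>(1 - q)\<^sup>L\<close>, with \<open>(m - l)\<^bsup>m - 2\<^esup>\<close> trees in which \<open>l\<close> given vertices
are leaves. At least three vertices are needed, since in the tree with one edge both vertices are leaves.
\<close>

lemma tree_weight_eq:
  assumes V: "finite V" "3 \<le> card V"
  shows "tree_weight V (1 - q) = tree_number (card V) q"
proof -
  have eq: "card {T \<in> labelled_trees V. L \<subseteq> low_degree V T} = (card V - card L) ^ (card V - 2)"
    if L: "L \<subseteq> V" for L
  proof (cases "L = V")
    case True
    have "{T \<in> labelled_trees V. L \<subseteq> low_degree V T} = {}" using no_tree_all_low[OF V] True by auto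
    thus ?thesis using V True by (simp only: card.empty) simp
  next
    case False
    have fL: "finite L" using L V finite_subset by blast
    have cd: "card (V - L) = card V - card L" using card_Diff_subset[OF fL L] .
    have "card L < card V" using L False V psubset_card_mono by blast
    hence pos: "card (V - L) > 0" using cd by auto
    hence ne: "V - L \<noteq> {}" by force
    have *: "card {T \<in> labelled_trees V. L \<subseteq> low_degree V T} =
          (card V - card L) ^ (card L + (card V - card L - 2))"
      using card_trees_low[OF V(1) L False] card_trees[of "V - L", OF _ ne] V cd by (simp add: power_add)
    show ?thesis
    proof (cases "card V - card L = 1")
      case True thus ?thesis using * by simp
    next
      case False
      hence "card L + (card V - card L - 2) = card V - 2" using pos cd by auto
      thus ?thesis using * by simp
    qed
  qed
  have "tree_weight V (1 - q) = (\<Sum>L\<in>Pow V. (- q) ^ card L * real ((card V - card L) ^ (card V - 2)))"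
    unfolding tree_weight_inclusion_exclusion[OF V(1)] using eq by (intro sum.cong) auto
  also have "\<dots> = (\<Sum>l\<le>card V. (card V choose l) * ((- q) ^ l * real ((card V - l) ^ (card V - 2))))"
    using sum_Pow_card[OF V(1), of "\<lambda>l. (- q) ^ l * real ((card V - l) ^ (card V - 2))"] .
  also have "\<dots> = tree_number (card V) q" by (simp add: tree_number_def mult.assoc)
  finally show ?thesis .
qed

section \<open>The weighted number of trees by Fourier inversion\<close>

text \<open>
Cauchy's formula for the \<open>n\<close>-th derivative of \<open>u \<mapsto> exp (- a u)\<close> at the origin, on the unit circle. The
negated argument makes the parametrisation start at \<open>-1\<close>, so that the angle runs from \<open>-\<pi>\<close> to \<open>\<pi>\<close> and
the rescaled ranges of integration exhaust the real line.
\<close>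

lemma exp_coefficient_fourier:
  fixes a :: complex
  shows "((\<lambda>t. exp (a * cis t) * cis (- (real n * t))) has_integral (2 * of_real pi * a ^ n / fact n)) {- pi..pi}"
proof -
  define F where "F t = exp (a * cis t) * cis (- (real n * t))" for t :: real
  have deriv: "(deriv ^^ n) (\<lambda>u. exp (- a * u)) = (\<lambda>u. (- a) ^ n * exp (- a * u))" for n
  proof (induction n)
    case (Suc n)
    have "deriv (\<lambda>u. (- a) ^ n * exp (- a * u)) u = (- a) ^ Suc n * exp (- a * u)" for u
      by (intro DERIV_imp_deriv) (auto intro!: derivative_eq_intros)
    hence "deriv (\<lambda>u. (- a) ^ n * exp (- a * u)) = (\<lambda>u. (- a) ^ Suc n * exp (- a * u))" by (rule ext)
    thus ?case by (simp only: funpow.simps comp_def Suc)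
  qed simp
  have "((\<lambda>u. exp (- a * u) / (u - 0) ^ Suc n) has_contour_integral
      (2 * pi * \<i> / fact n * (deriv ^^ n) (\<lambda>u. exp (- a * u)) 0)) (circlepath 0 1)"
    by (intro Cauchy_has_contour_integral_higher_derivative_circlepath continuous_intros holomorphic_intros) auto
  hence "((\<lambda>x. exp (- a * circlepath 0 1 x) / circlepath 0 1 x ^ Suc n *
      vector_derivative (circlepath 0 1) (at x)) has_integral (2 * pi * \<i> / fact n * (- a) ^ n)) {0..1}"
    unfolding has_contour_integral deriv by simp
  moreover have "exp (- a * circlepath 0 1 x) / circlepath 0 1 x ^ Suc n *
      vector_derivative (circlepath 0 1) (at x) = 2 * pi * \<i> * (- 1) ^ n * F (2 * pi * x - pi)" for x
  proof -
    have c: "circlepath 0 1 x = - cis (2 * pi * x - pi)"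
      by (simp add: circlepath cis_conv_exp exp_diff right_diff_distrib mult_ac)
    have d: "vector_derivative (circlepath 0 1) (at x) = 2 * pi * \<i> * circlepath 0 1 x"
      unfolding vector_derivative_circlepath by (simp add: circlepath)
    have nz: "circlepath 0 1 x \<noteq> 0" using c by simp
    have "exp (- a * circlepath 0 1 x) / circlepath 0 1 x ^ Suc n * vector_derivative (circlepath 0 1) (at x) =
        2 * pi * \<i> * (exp (- a * circlepath 0 1 x) / circlepath 0 1 x ^ n)"
      using nz by (simp add: d)
    also have "circlepath 0 1 x ^ n = (- 1) ^ n * cis (real n * (2 * pi * x - pi))"
      unfolding c by (subst power_minus) (simp only: Complex.DeMoivre)
    also have "exp (- a * circlepath 0 1 x) / ((- 1) ^ n * cis (real n * (2 * pi * x - pi))) =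
        (- 1) ^ n * F (2 * pi * x - pi)"
    proof -
      have inv: "cis (- (real n * t)) = 1 / cis (real n * t)" for t
        by (simp add: divide_inverse flip: cis_inverse)
      have "exp (- a * - cis t) / ((- 1) ^ n * cis (real n * t)) = (- 1) ^ n * F t" for t
        unfolding F_def inv by (simp add: field_simps flip: power_mult_distrib)
      thus ?thesis unfolding c .
    qed
    finally show ?thesis by simp
  qed
  ultimately have "((\<lambda>x. 2 * pi * \<i> * (- 1) ^ n * F (2 * pi * x - pi)) has_integral
      (2 * pi * \<i> / fact n * (- a) ^ n)) {0..1}" by simp
  hence "((\<lambda>x. 1 / (2 * pi * \<i> * (- 1) ^ n) * (2 * pi * \<i> * (- 1) ^ n * F (2 * pi * x - pi))) has_integral
      (1 / (2 * pi * \<i> * (- 1) ^ n) * (2 * pi * \<i> / fact n * (- a) ^ n))) {0..1}"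
    by (rule has_integral_mult_right)
  hence "((\<lambda>x. F (2 * pi * x - pi)) has_integral (a ^ n / fact n)) {0..1}"
    by (simp add: power_minus[of a])
  hence "((\<lambda>t. F (2 * pi * ((1 / (2 * pi)) *\<^sub>R t + 1 / 2) - pi)) has_integral
     ((a ^ n / fact n) /\<^sub>R (1 / (2 * pi)) ^ DIM(real)))
     (cbox ((0 - 1 / 2) /\<^sub>R (1 / (2 * pi))) ((1 - 1 / 2) /\<^sub>R (1 / (2 * pi))))"
    by (intro has_integral_affinity') auto
  thus ?thesis by (simp add: F_def[abs_def] algebra_simps scaleR_conv_of_real)
qed

lemma norm_exp_tail2_le:
  fixes z :: complex
  shows "norm (exp z - 1 - z) \<le> exp (norm z) - 1 - norm z"
proof -
  have s: "summable (\<lambda>n. inverse (fact (n + 2)) *\<^sub>R (norm z ^ (n + 2)))"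
    by (rule summable_ignore_initial_segment[OF summable_exp_generic])
  have "norm (\<Sum>n. inverse (fact (n + 2)) *\<^sub>R (z ^ (n + 2))) \<le>
      (\<Sum>n. inverse (fact (n + 2)) *\<^sub>R (norm z ^ (n + 2)))"
    by (rule norm_suminf_le[OF _ s]) (simp add: norm_power norm_mult)
  thus ?thesis using exp_first_two_terms[of z] exp_first_two_terms[of "norm z"] by simp
qed

lemma one_minus_cos_ge:
  fixes t :: real
  assumes "\<bar>t\<bar> \<le> pi"
  shows "1 - cos t \<ge> t\<^sup>2 / 18"
proof -
  \<comment> \<open>Since \<open>1 - cos t = 2 sin\<^sup>2 (t / 2)\<close>, the bound \<open>sin x \<ge> x - x\<^sup>3 / 6 \<ge> x / 3\<close> on \<open>[0, 2]\<close> is enough.\<close>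
  define x where "x = \<bar>t\<bar> / 2"
  have x: "0 \<le> x" "x \<le> 2" using assms pi_less_4 by (auto simp: x_def)
  have "x / 3 \<le> sin x"
  proof (cases "x = 0")
    case False
    hence "x > 0" using x by simp
    then obtain s where s: "sin x = (\<Sum>m<3. sin_coeff m * x ^ m) + sin (s + 1 / 2 * real 3 * pi) / fact 3 * x ^ 3"
      using Maclaurin_sin_expansion3[of 3 x] by auto
    have "sin (s + 1 / 2 * real 3 * pi) / fact 3 * x ^ 3 \<ge> (- 1) / fact 3 * x ^ 3"
      using x by (intro mult_right_mono divide_right_mono sin_ge_minus_one) auto
    moreover have "x\<^sup>2 \<le> 4" using power_mono[of x 2 2] x by simp
    hence "x * x\<^sup>2 \<le> x * 4" using x by (intro mult_left_mono) auto
    moreover have "(- 1) / fact 3 * x ^ 3 = - (x * x\<^sup>2) / 6"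
      by (simp add: fact_numeral power3_eq_cube power2_eq_square)
    moreover have "(\<Sum>m<3. sin_coeff m * x ^ m) = x"
      by (simp add: sin_coeff_def eval_nat_numeral lessThan_Suc)
    ultimately show ?thesis using s by linarith
  qed simp
  hence "(x / 3)\<^sup>2 \<le> (sin x)\<^sup>2" using x by (intro power_mono) auto
  moreover have "cos t = 1 - 2 * (sin x)\<^sup>2"
    using cos_double_sin[of x] by (simp add: x_def)
  ultimately show ?thesis by (simp add: x_def power_divide)
qed

text \<open>
The factors \<open>z\<^sub>n\<close> and \<open>exp (c / n)\<close> lie in the unit disc, so their \<open>n\<close>-th powers differ by at most \<open>n\<close> times the
difference of the factors, and both of these are \<open>1 + c / n + o(1 / n)\<close>.
\<close>

lemma power_tendsto_exp:
  fixes z :: "nat \<Rightarrow> complex" and c :: real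
  assumes le1: "\<And>n. norm (z n) \<le> 1" and c: "c \<le> 0"
    and lim: "(\<lambda>n. of_nat n * (z n - 1)) \<longlonglongrightarrow> of_real c"
  shows "(\<lambda>n. z n ^ n) \<longlonglongrightarrow> of_real (exp c)"
proof -
  define w :: "nat \<Rightarrow> complex" where "w n = of_real (exp (c / n))" for n
  have "(\<lambda>n. real n * (exp (c / n) - 1)) \<longlonglongrightarrow> c"
  proof (cases "c = 0")
    case False
    have "((\<lambda>x. (exp x - 1) / x) \<longlongrightarrow> (1::real)) (at 0)"
      using DERIV_exp[of "0::real"] by (simp add: has_field_derivative_iff)
    moreover have "filterlim (\<lambda>n. c / real n) (at 0) sequentially"
      unfolding filterlim_at using False
      by (auto intro!: tendsto_divide_0[OF tendsto_const] filterlim_at_top_imp_at_infinity filterlim_real_sequentially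
          eventually_mono[OF eventually_gt_at_top[of 0]])
    ultimately have "(\<lambda>n. (exp (c / real n) - 1) / (c / real n)) \<longlonglongrightarrow> 1"
      by (rule filterlim_compose)
    hence "(\<lambda>n. c * ((exp (c / real n) - 1) / (c / real n))) \<longlonglongrightarrow> c * 1"
      by (intro tendsto_mult tendsto_const)
    moreover have "c * ((exp (c / real n) - 1) / (c / real n)) = real n * (exp (c / n) - 1)" for n
      using False by (cases "n = 0") auto
    ultimately show ?thesis by simp
  qed simp
  hence "(\<lambda>n. complex_of_real (real n * (exp (c / n) - 1))) \<longlonglongrightarrow> of_real c" by (rule tendsto_of_real)
  hence "(\<lambda>n. of_nat n * (w n - 1)) \<longlonglongrightarrow> of_real c" by (simp add: w_def)
  hence "(\<lambda>n. of_nat n * (z n - 1) - of_nat n * (w n - 1)) \<longlonglongrightarrow> of_real c - of_real c"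
    by (intro tendsto_diff lim)
  hence "(\<lambda>n. of_nat n * (z n - w n)) \<longlonglongrightarrow> 0" by (simp add: algebra_simps)
  hence lim0: "(\<lambda>n. norm (of_nat n * (z n - w n))) \<longlonglongrightarrow> 0" by (rule tendsto_norm_zero)
  have "norm (w n) \<le> 1" for n
    using c by (auto simp: w_def divide_nonpos_nonneg)
  hence "norm (z n ^ n - w n ^ n) \<le> norm (of_nat n * (z n - w n))" for n
    using norm_power_diff[of "z n" "w n" n] le1 by (simp add: norm_mult)
  hence "(\<lambda>n. z n ^ n - w n ^ n) \<longlonglongrightarrow> 0"
    by (intro Lim_null_comparison[OF _ lim0]) auto
  moreover have "\<forall>\<^sub>F n in sequentially. w n ^ n = of_real (exp c)"
    using eventually_gt_at_top[of 0]
    by eventually_elim (simp add: w_def flip: of_real_power exp_of_nat_mult)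
  ultimately have "(\<lambda>n. (z n ^ n - w n ^ n) + w n ^ n) \<longlonglongrightarrow> 0 + of_real (exp c)"
    by (intro tendsto_add) (auto intro: tendsto_eventually)
  thus ?thesis by simp
qed

text \<open>
The parameter \<open>q\<close> for which \<open>r\<close> is the saddle point of \<open>(e\<^sup>x - q) / x\<close>.
\<close>

definition defect :: "real \<Rightarrow> real" where
  "defect r = (1 - r) * exp r"

text \<open>
The characteristic function of \<open>X - 1\<close>, where \<open>X\<close> has the probability generating function
\<open>z \<mapsto> (exp (r z) - q) / (r exp r)\<close> with \<open>q = defect r\<close>. The choice of \<open>q\<close> makes the mean of \<open>X\<close> equal to \<open>1\<close>; its
variance is \<open>r\<close>.
\<close>

definition step_char :: "real \<Rightarrow> real \<Rightarrow> complex" where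
  "step_char r t = (exp (r * cis t) - defect r) / (r * exp r) * cis (- t)"

lemma defect_less_1: "0 < r \<Longrightarrow> defect r < 1"
proof -
  assume "0 < r"
  hence "1 - r < exp (- r)" by (simp add: exp_minus_greater)
  hence "(1 - r) * exp r < exp (- r) * exp r" by (intro mult_strict_right_mono) auto
  thus ?thesis by (simp add: defect_def flip: exp_add)
qed

text \<open>
The constant and the linear coefficient of \<open>exp (r z) - q\<close> are both positive, so they cannot be aligned on
the unit circle away from \<open>z = 1\<close>: \<open>\<bar>a + r z\<bar>\<close> falls short of \<open>a + r\<close> by a multiple of \<open>t\<^sup>2\<close>. The other
coefficients are estimated trivially.
\<close>

lemma norm_step_char_le:
  assumes r: "0 < r"
  obtains c where "c > 0" "\<And>t. \<bar>t\<bar> \<le> pi \<Longrightarrow> norm (step_char r t) \<le> exp (- c * t\<^sup>2)"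
proof -
  define a where "a = 1 - defect r"
  define b where "b = a + r"
  have a: "0 < a" using defect_less_1[OF r] by (simp add: a_def)
  have b: "0 < b" using a r by (simp add: b_def)
  define c where "c = a * r / (18 * b) / (r * exp r)"
  have "norm (step_char r t) \<le> exp (- c * t\<^sup>2)" if t: "\<bar>t\<bar> \<le> pi" for t
  proof -
    define d where "d = a * r * t\<^sup>2 / (18 * b)"
    have d0: "0 \<le> d" using a b r by (simp add: d_def)
    have "\<bar>t\<bar>\<^sup>2 \<le> 4\<^sup>2" using t pi_less_4 by (intro power_mono) auto
    hence t16: "t\<^sup>2 \<le> 16" by simp
    have "d \<le> b"
    proof -
      have "a * r * t\<^sup>2 \<le> a * r * 16" using t16 a r by (intro mult_left_mono) auto
      also have "\<dots> \<le> 18 * b\<^sup>2" using a r by (simp add: b_def power2_eq_square algebra_simps)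
      finally show ?thesis using b by (simp add: d_def field_simps power2_eq_square)
    qed
    have "(norm (a + r * cis t))\<^sup>2 = b\<^sup>2 - 2 * a * r * (1 - cos t)"
    proof -
      have "(norm (a + r * cis t))\<^sup>2 = (a + r * cos t)\<^sup>2 + (r * sin t)\<^sup>2"
        by (simp add: cmod_power2)
      also have "\<dots> = a\<^sup>2 + 2 * a * r * cos t + r\<^sup>2 * ((cos t)\<^sup>2 + (sin t)\<^sup>2)"
        by algebra
      also have "\<dots> = a\<^sup>2 + 2 * a * r * cos t + r\<^sup>2" by simp
      also have "\<dots> = b\<^sup>2 - 2 * a * r * (1 - cos t)"
        by (simp add: b_def power2_eq_square algebra_simps)
      finally show ?thesis .
    qed
    also have "\<dots> \<le> b\<^sup>2 - 2 * a * r * (t\<^sup>2 / 18)"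
      using one_minus_cos_ge[OF t] a r by (intro diff_left_mono mult_left_mono) auto
    also have "\<dots> = b\<^sup>2 - 2 * b * d" using b by (simp add: d_def)
    also have "\<dots> \<le> (b - d)\<^sup>2" by (simp add: power2_eq_square algebra_simps)
    finally have sq: "(norm (a + r * cis t))\<^sup>2 \<le> (b - d)\<^sup>2" .
    \<comment> \<open>The constant and linear terms produce the quadratic gain \<open>d\<close>; the higher terms lose nothing.\<close>
    have n1: "norm (a + r * cis t) \<le> b - d"
      by (rule power2_le_imp_le[OF sq]) (use \<open>d \<le> b\<close> in linarith)
    have n2: "norm (exp (r * cis t) - 1 - r * cis t) \<le> exp r - 1 - r"
      using norm_exp_tail2_le[of "r * cis t"] r by (simp add: norm_mult)
    have "exp (r * cis t) - defect r = (a + r * cis t) + (exp (r * cis t) - 1 - r * cis t)"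
      by (simp add: a_def)
    hence "norm (exp (r * cis t) - defect r) \<le> norm (a + r * cis t) + norm (exp (r * cis t) - 1 - r * cis t)"
      by (simp only: norm_triangle_ineq)
    also have "\<dots> \<le> (b - d) + (exp r - 1 - r)" using n1 n2 by (rule add_mono)
    also have "\<dots> = r * exp r - d" by (simp add: a_def b_def defect_def algebra_simps)
    finally have "norm (exp (r * cis t) - defect r) / (r * exp r) \<le> (r * exp r - d) / (r * exp r)"
      using r by (intro divide_right_mono) auto
    also have "\<dots> = 1 + (- c * t\<^sup>2)" using r by (simp add: c_def d_def field_simps)
    also have "\<dots> \<le> exp (- c * t\<^sup>2)" by (rule exp_ge_add_one_self)
    finally show ?thesis using r by (simp add: step_char_def norm_mult norm_divide)
  qed
  moreover have "c > 0" using a b r by (simp add: c_def)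
  ultimately show thesis using that by blast
qed

text \<open>
Taylor's formula of order two at the origin for the entire function whose restriction to the
imaginary axis is the characteristic function.
\<close>

lemma step_char_expansion:
  assumes r: "0 < r"
  obtains B where "B \<ge> 0" "\<And>t. \<bar>t\<bar> \<le> 1 \<Longrightarrow> norm (step_char r t - 1 + r / 2 * t\<^sup>2) \<le> B * \<bar>t\<bar> ^ 3"
proof -
  define K :: complex where "K = 1 / (r * exp r)"
  define q :: complex where "q = defect r"
  define u :: "complex \<Rightarrow> complex" where "u z = of_real r * exp z" for z
  define A where "A z = exp (u z - z)" for z
  \<comment> \<open>The function with its first three derivatives, in terms of \<open>u = r exp z\<close> and \<open>A = exp (u - z)\<close>, for which \<open>A' = A (u - 1)\<close>.\<close>
  define f :: "nat \<Rightarrow> complex \<Rightarrow> complex" where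
    "f i = [\<lambda>z. K * (A z - q * exp (- z)),
            \<lambda>z. K * (A z * (u z - 1) + q * exp (- z)),
            \<lambda>z. K * (A z * ((u z - 1)\<^sup>2 + u z) - q * exp (- z)),
            \<lambda>z. K * (A z * ((u z - 1) ^ 3 + 3 * u z * (u z - 1) + u z) + q * exp (- z))] ! i" for i
  have du: "(u has_field_derivative u z) (at z within S)" for z S
    unfolding u_def by (auto intro!: derivative_eq_intros)
  have dA: "(A has_field_derivative A z * (u z - 1)) (at z within S)" for z S
    unfolding A_def by (auto intro!: derivative_eq_intros du simp: mult.commute)
  have df: "(f i has_field_derivative f (Suc i) z) (at z within S)" if "i \<le> 2" for i z S
  proof -
    have "i = 0 \<or> i = 1 \<or> i = 2" using that by auto
    thus ?thesis
      by (elim disjE; simp add: f_def; auto intro!: derivative_eq_intros du dA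
          simp: algebra_simps power2_eq_square power3_eq_cube)
  qed
  have "continuous_on (cball 0 1) (f 3)"
    unfolding f_def A_def u_def by (auto intro!: continuous_intros simp: numeral_3_eq_3)
  hence "bounded (f 3 ` cball 0 1)" by (intro compact_imp_bounded compact_continuous_image) auto
  then obtain B where "\<forall>x\<in>f 3 ` cball 0 1. norm x \<le> B" unfolding bounded_iff by blast
  hence B: "\<And>z. z \<in> cball 0 1 \<Longrightarrow> norm (f 3 z) \<le> B" by blast
  have B0: "0 \<le> B" using B[of 0] norm_ge_zero[of "f 3 0"] by (meson centre_in_cball order_trans zero_le_one)
  have rne: "complex_of_real r \<noteq> 0" using r by simp
  have f00: "f 0 0 = 1" "f 1 0 = 0" "f 2 0 = r"
    using rne by (simp_all add: f_def K_def A_def u_def q_def defect_def exp_of_real field_simps power2_eq_square)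
  have "norm (step_char r t - 1 + r / 2 * t\<^sup>2) \<le> B / 2 * \<bar>t\<bar> ^ 3" if t: "\<bar>t\<bar> \<le> 1" for t :: real
  proof -
    have taylor: "norm (f 0 (\<i> * t) - (\<Sum>i\<le>2. f i 0 * (\<i> * t - 0) ^ i / fact i)) \<le> B * norm (\<i> * t - 0) ^ Suc 2 / fact 2"
      using t by (intro complex_Taylor[of "cball 0 1"] df)
        (auto simp: norm_mult B numeral_3_eq_3 intro: B[unfolded numeral_3_eq_3])
    have val: "f 0 (\<i> * t) = step_char r t"
      by (simp add: f_def K_def A_def u_def q_def step_char_def cis_conv_exp exp_diff exp_minus field_simps exp_of_real)
    have poly: "(\<Sum>i\<le>2. f i 0 * (\<i> * t - 0) ^ i / fact i) = 1 - r / 2 * t\<^sup>2"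
      using f00 by (simp add: eval_nat_numeral atMost_Suc power_mult_distrib)
    have "step_char r t - 1 + r / 2 * t\<^sup>2 = step_char r t - complex_of_real (1 - r / 2 * t\<^sup>2)"
      by simp
    hence "norm (step_char r t - 1 + r / 2 * t\<^sup>2) \<le> B * norm (\<i> * t - 0) ^ Suc 2 / fact 2"
      using taylor unfolding val poly by (simp only:)
    thus ?thesis by (simp add: norm_mult fact_numeral numeral_3_eq_3)
  qed
  thus thesis using that[of "B / 2"] B0 by auto
qed


lemma gaussian_integral:
  assumes "a > 0"
  shows "integrable lborel (\<lambda>x::real. exp (- a * x\<^sup>2))"
    and "(\<integral>x. exp (- a * x\<^sup>2) \<partial>lborel) = sqrt (pi / a)"
proof -
  \<comment> \<open>The standard deviation for which the normal density is proportional to the integrand.\<close>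
  define \<sigma> where "\<sigma> = sqrt (1 / (2 * a))"
  have s2: "\<sigma>\<^sup>2 = 1 / (2 * a)" using assms by (simp add: \<sigma>_def)
  have eq: "exp (- a * x\<^sup>2) = sqrt (pi / a) * normal_density 0 \<sigma> x" for x
    using assms by (simp add: normal_density_def s2 real_sqrt_divide real_sqrt_mult field_simps)
  have "\<sigma> > 0" using assms by (simp add: \<sigma>_def)
  thus "integrable lborel (\<lambda>x::real. exp (- a * x\<^sup>2))"
    and "(\<integral>x. exp (- a * x\<^sup>2) \<partial>lborel) = sqrt (pi / a)"
    unfolding eq by (auto intro!: integrable_mult_right)
qed

text \<open>
The local limit theorem for the sum of \<open>m\<close> steps. After the substitution \<open>t = s / \<surd>m\<close> the integrand
converges to \<open>exp (- r s\<^sup>2 / 2)\<close> by the expansion at the origin, and \<open>norm_step_char_le\<close> provides a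
Gaussian majorant that does not depend on \<open>m\<close>.
\<close>

lemma step_char_integral_tendsto:
  assumes r: "0 < r"
  shows "(\<lambda>m. of_real (sqrt m) * integral {- pi..pi} (\<lambda>t. step_char r t ^ m * cis (2 * t)))
    \<longlonglongrightarrow> of_real (sqrt (2 * pi / r))"
proof -
  obtain c where c: "c > 0" "\<And>t. \<bar>t\<bar> \<le> pi \<Longrightarrow> norm (step_char r t) \<le> exp (- c * t\<^sup>2)"
    using norm_step_char_le[OF r] by blast
  obtain B where B: "B \<ge> 0"
    "\<And>t. \<bar>t\<bar> \<le> 1 \<Longrightarrow> norm (step_char r t - 1 + r / 2 * t\<^sup>2) \<le> B * \<bar>t\<bar> ^ 3"
    using step_char_expansion[OF r] by blast
  define h where "h m t = step_char r t ^ m * cis (2 * t)" for m :: nat and t :: real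
  \<comment> \<open>At \<open>m = 0\<close> the quotient \<open>s / sqrt m\<close> is \<open>0\<close> for every \<open>s\<close>, which would violate the Gaussian bound.\<close>
  define f where "f m s = (if m = 0 then 0 else indicator {- pi..pi} (s / sqrt m) *\<^sub>R h m (s / sqrt m))" for m :: nat and s :: real
  have cont: "continuous_on UNIV (h m)" for m
    unfolding h_def step_char_def by (intro continuous_intros) (use r in auto)
  have meas: "h m \<in> borel_measurable borel" for m
    using cont by (rule borel_measurable_continuous_onI)
  have step_bound: "norm (step_char r t ^ m) \<le> exp (- c * (m * t\<^sup>2))" if "\<bar>t\<bar> \<le> pi" for t m
  proof -
    have "norm (step_char r t ^ m) \<le> exp (- c * t\<^sup>2) ^ m"
      unfolding norm_power by (intro power_mono c that) auto
    thus ?thesis by (simp add: mult_ac flip: exp_of_nat_mult)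
  qed
  have lim: "(\<lambda>m. f m s) \<longlonglongrightarrow> of_real (exp (- (r / 2) * s\<^sup>2))" for s
  proof -
    \<comment> \<open>The value \<open>1\<close> for small \<open>m\<close> keeps all \<open>z m\<close> in the unit disc, where \<open>power_tendsto_exp\<close> applies.\<close>
    define z where "z m = (if \<bar>s / sqrt m\<bar> \<le> 1 then step_char r (s / sqrt m) else 1)" for m :: nat
    have ev: "\<forall>\<^sub>F m in sequentially. m > 0 \<and> \<bar>s / sqrt m\<bar> \<le> 1"
      using eventually_gt_at_top[of 0] eventually_ge_at_top[of "nat \<lceil>s\<^sup>2\<rceil>"]
    proof eventually_elim
      case (elim m)
      hence "s\<^sup>2 \<le> real m" by linarith
      hence "sqrt (s\<^sup>2) \<le> sqrt (real m)" by (rule real_sqrt_le_mono)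
      thus ?case using elim by simp
    qed
    have small: "\<bar>s / sqrt m\<bar> \<le> pi" if "\<bar>s / sqrt m\<bar> \<le> 1" for m :: nat
      using that pi_gt3 by linarith
    have "(\<lambda>m. z m ^ m) \<longlonglongrightarrow> of_real (exp (- (r / 2) * s\<^sup>2))"
    proof (rule power_tendsto_exp)
      show "norm (z m) \<le> 1" for m
      proof (cases "\<bar>s / sqrt m\<bar> \<le> 1")
        case True
        hence "norm (step_char r (s / sqrt m)) \<le> exp (- c * (s / sqrt m)\<^sup>2)" by (intro c small)
        also have "\<dots> \<le> 1" using c(1) by simp
        finally show ?thesis using True by (simp add: z_def)
      qed (simp add: z_def)
      show "- (r / 2) * s\<^sup>2 \<le> 0" using r by simp
      have "\<forall>\<^sub>F m in sequentially. norm (of_nat m * (z m - 1) - of_real (- (r / 2) * s\<^sup>2)) \<le> B * \<bar>s\<bar> ^ 3 / sqrt m"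
        using ev
      proof eventually_elim
        case (elim m)
        define t where "t = s / sqrt m"
        have mt: "real m * t\<^sup>2 = s\<^sup>2" using elim by (simp add: t_def power_divide)
        have "of_nat m * (z m - 1) - of_real (- (r / 2) * s\<^sup>2) = of_nat m * (step_char r t - 1 + r / 2 * t\<^sup>2)"
          using elim by (simp add: z_def t_def[symmetric] mt[symmetric] algebra_simps)
        hence "norm (of_nat m * (z m - 1) - of_real (- (r / 2) * s\<^sup>2)) = m * norm (step_char r t - 1 + r / 2 * t\<^sup>2)"
          by (simp add: norm_mult)
        also have "\<dots> \<le> m * (B * \<bar>t\<bar> ^ 3)"
          using elim by (intro mult_left_mono B(2)) (auto simp: t_def)
        also have "\<dots> = B * \<bar>s\<bar> ^ 3 / sqrt m"
        proof -
          have "sqrt m ^ 2 = m" by simp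
          thus ?thesis using elim
            by (simp add: t_def power_divide abs_divide field_simps power2_eq_square power3_eq_cube)
        qed
        finally show ?case .
      qed
      moreover have "(\<lambda>m. B * \<bar>s\<bar> ^ 3 / sqrt (real m)) \<longlonglongrightarrow> 0"
        by (intro tendsto_divide_0[OF tendsto_const] filterlim_at_top_imp_at_infinity
            filterlim_compose[OF sqrt_at_top] filterlim_real_sequentially)
      ultimately have "(\<lambda>m. of_nat m * (z m - 1) - of_real (- (r / 2) * s\<^sup>2)) \<longlonglongrightarrow> 0"
        by (rule Lim_null_comparison)
      thus "(\<lambda>m. of_nat m * (z m - 1)) \<longlonglongrightarrow> of_real (- (r / 2) * s\<^sup>2)"
        by (rule LIM_zero_cancel)
    qed
    moreover have "(\<lambda>m. cis (2 * (s / sqrt (real m)))) \<longlonglongrightarrow> cis (2 * 0)"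
      unfolding cis_conv_exp
      by (intro tendsto_intros tendsto_divide_0[OF tendsto_const] filterlim_at_top_imp_at_infinity
            filterlim_compose[OF sqrt_at_top] filterlim_real_sequentially)
    ultimately have "(\<lambda>m. z m ^ m * cis (2 * (s / sqrt (real m)))) \<longlonglongrightarrow> of_real (exp (- (r / 2) * s\<^sup>2)) * cis (2 * 0)"
      by (rule tendsto_mult)
    moreover have "\<forall>\<^sub>F m in sequentially. z m ^ m * cis (2 * (s / sqrt (real m))) = f m s"
      using ev
    proof eventually_elim
      case (elim m)
      hence "\<bar>s / sqrt m\<bar> \<le> pi" using small by blast
      hence "s / sqrt m \<in> {- pi..pi}" by (simp only: abs_le_iff atLeastAtMost_iff minus_le_iff)
      thus ?case using elim by (simp add: f_def h_def z_def)
    qed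
    ultimately show ?thesis by (simp add: tendsto_cong)
  qed
  have "(\<lambda>m. \<integral>s. f m s \<partial>lborel) \<longlonglongrightarrow> (\<integral>s. of_real (exp (- (r / 2) * s\<^sup>2)) \<partial>lborel)"
  proof (rule integral_dominated_convergence)
    show "(\<lambda>s. complex_of_real (exp (- (r / 2) * s\<^sup>2))) \<in> borel_measurable lborel"
      by measurable
    show "f m \<in> borel_measurable lborel" for m
      unfolding f_def using meas by (cases "m = 0") (auto intro!: measurable_compose[OF _ meas])
    show "integrable lborel (\<lambda>s::real. exp (- c * s\<^sup>2))" by (rule gaussian_integral[OF c(1)])
    show "AE s in lborel. (\<lambda>m. f m s) \<longlonglongrightarrow> complex_of_real (exp (- (r / 2) * s\<^sup>2))"
      using lim by simp
    have "norm (f m s) \<le> exp (- c * s\<^sup>2)" for m s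
    proof (cases "m \<noteq> 0 \<and> s / sqrt m \<in> {- pi..pi}")
      case True
      hence "\<bar>s / sqrt m\<bar> \<le> pi" by (simp only: abs_le_iff) auto
      hence "norm (step_char r (s / sqrt m) ^ m) \<le> exp (- c * (m * (s / sqrt m)\<^sup>2))"
        by (rule step_bound)
      thus ?thesis using True by (simp add: f_def h_def norm_mult power_divide)
    qed (auto simp: f_def)
    thus "AE s in lborel. norm (f m s) \<le> exp (- c * s\<^sup>2)" for m by simp
  qed
  also have "(\<integral>s. complex_of_real (exp (- (r / 2) * s\<^sup>2)) \<partial>lborel) = of_real (sqrt (pi / (r / 2)))"
    unfolding integral_complex_of_real using gaussian_integral(2)[of "r / 2"] r by simp
  also have "sqrt (pi / (r / 2)) = sqrt (2 * pi / r)" by (simp add: field_simps)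
  finally have main: "(\<lambda>m. \<integral>s. f m s \<partial>lborel) \<longlonglongrightarrow> of_real (sqrt (2 * pi / r))" .
  have scale: "(\<integral>s. f m s \<partial>lborel) = of_real (sqrt m) * integral {- pi..pi} (h m)" if "m > 0" for m
  proof -
    have "(\<integral>s. f m s \<partial>lborel) = \<bar>sqrt m\<bar> *\<^sub>R (\<integral>t. f m (0 + sqrt m * t) \<partial>lborel)"
      using that by (intro lborel_integral_real_affine) auto
    also have "(\<lambda>t. f m (0 + sqrt m * t)) = (\<lambda>t. indicator {- pi..pi} t *\<^sub>R h m t)"
      using that by (simp add: f_def fun_eq_iff)
    also have "(\<integral>t. indicator {- pi..pi} t *\<^sub>R h m t \<partial>lborel) = integral {- pi..pi} (h m)"
      using set_borel_integral_eq_integral(2)[OF borel_integrable_atLeastAtMost', of "- pi" pi "h m"]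
        continuous_on_subset[OF cont] by (simp add: set_lebesgue_integral_def)
    finally show ?thesis by (simp add: scaleR_conv_of_real)
  qed
  have "\<forall>\<^sub>F m in sequentially. (\<integral>s. f m s \<partial>lborel) = of_real (sqrt m) * integral {- pi..pi} (h m)"
    using eventually_gt_at_top[of 0] by eventually_elim (rule scale)
  from tendsto_cong[THEN iffD1, OF this main] show ?thesis
    unfolding h_def .
qed


text \<open>
Binomial expansion of the \<open>m\<close>-th power and \<open>exp_coefficient_fourier\<close> for each term. The factor
\<open>cis (2 t)\<close> appears because the coefficient of index \<open>m - 2\<close> is wanted, not that of index \<open>m\<close>.
\<close>

lemma tree_number_fourier:
  assumes r: "0 < r" and m: "2 \<le> m"
  shows "integral {- pi..pi} (\<lambda>t. step_char r t ^ m * cis (2 * t)) =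
    of_real (2 * pi * tree_number m (defect r) / (fact (m - 2) * r\<^sup>2 * exp (r * m)))"
proof -
  define n where "n = m - 2"
  have mn: "m = n + 2" using m by (simp add: n_def)
  define q :: complex where "q = defect r"
  define K :: complex where "K = 1 / of_real ((r * exp r) ^ m)"
  have expand: "step_char r t ^ m * cis (2 * t) =
      (\<Sum>l\<le>m. K * of_nat (m choose l) * (- q) ^ l * (exp (of_nat (m - l) * r * cis t) * cis (- (real n * t))))" for t
  proof -
    have "step_char r t ^ m * cis (2 * t) = K * (- q + exp (r * cis t)) ^ m * (cis (- t) ^ m * cis (2 * t))"
      by (simp add: step_char_def K_def q_def power_mult_distrib power_divide exp_of_real mult_ac)
    also have "cis (- t) ^ m * cis (2 * t) = cis (- (real n * t))"
      by (simp add: Complex.DeMoivre cis_mult mn algebra_simps)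
    also have "(- q + exp (r * cis t)) ^ m = (\<Sum>l\<le>m. of_nat (m choose l) * (- q) ^ l * exp (r * cis t) ^ (m - l))"
      by (rule binomial_ring)
    finally show ?thesis
      by (simp add: sum_distrib_left sum_distrib_right mult.assoc flip: exp_of_nat_mult)
  qed
  have "((\<lambda>t. step_char r t ^ m * cis (2 * t)) has_integral
      (\<Sum>l\<le>m. K * of_nat (m choose l) * (- q) ^ l * (2 * of_real pi * of_real (real (m - l) * r) ^ n / fact n))) {- pi..pi}"
    unfolding expand
    by (intro has_integral_sum[OF finite_atMost] has_integral_mult_right exp_coefficient_fourier)
  hence "integral {- pi..pi} (\<lambda>t. step_char r t ^ m * cis (2 * t)) =
      (\<Sum>l\<le>m. K * of_nat (m choose l) * (- q) ^ l * (2 * of_real pi * of_real (real (m - l) * r) ^ n / fact n))"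
    by (rule integral_unique)
  also have "\<dots> = K * 2 * pi * r ^ n / fact n * of_real (tree_number m (defect r))"
    unfolding tree_number_def n_def[symmetric] of_real_sum sum_distrib_left
    by (intro sum.cong) (simp_all add: q_def power_mult_distrib)
  also have "K * 2 * pi * r ^ n / fact n = of_real (2 * pi / (fact n * r\<^sup>2 * exp (r * m)))"
  proof -
    have "(r * exp r) ^ m = r ^ n * r\<^sup>2 * exp (r * m)"
    proof -
      have "exp r ^ m = exp (r * m)" by (simp add: mult.commute flip: exp_of_nat_mult)
      moreover have "r ^ m = r ^ n * r\<^sup>2" unfolding mn by (rule power_add)
      ultimately show ?thesis by (simp only: power_mult_distrib)
    qed
    thus ?thesis using r by (simp add: K_def)
  qed
  finally show ?thesis by (simp add: n_def)
qed

lemma tree_number_0 [simp]: "tree_number m 0 = real m ^ (m - 2)"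
proof -
  have "tree_number m 0 = (\<Sum>l\<in>{0}. real (m choose l) * (- 0) ^ l * real (m - l) ^ (m - 2))"
    unfolding tree_number_def by (intro sum.mono_neutral_right) auto
  thus ?thesis by simp
qed

text \<open>
The quotient of the local limit theorems for \<open>r\<close> and for \<open>1\<close>. As \<open>defect 1 = 0\<close> and
\<open>tree_number m 0 = m\<^bsup>m - 2\<^esup>\<close>, the factorials and the factor \<open>\<surd>m\<close> cancel, and Stirling's formula is avoided.
\<close>

lemma tree_number_tendsto:
  assumes r: "0 < r"
  shows "(\<lambda>m. tree_number m (defect r) / real m ^ (m - 2) * exp ((1 - r) * m)) \<longlonglongrightarrow> r\<^sup>2 / sqrt r"
proof -
  define X where "X r m = sqrt m * (2 * pi * tree_number m (defect r) / (fact (m - 2) * r\<^sup>2 * exp (r * m)))"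
    for r and m :: nat
  have X: "X r \<longlonglongrightarrow> sqrt (2 * pi / r)" if "0 < r" for r
  proof -
    have "\<forall>\<^sub>F m in sequentially. of_real (sqrt m) * integral {- pi..pi} (\<lambda>t. step_char r t ^ m * cis (2 * t)) =
        complex_of_real (X r m)"
      using eventually_ge_at_top[of 2]
      by eventually_elim (simp add: tree_number_fourier[OF that] X_def)
    hence "(\<lambda>m. complex_of_real (X r m)) \<longlonglongrightarrow> of_real (sqrt (2 * pi / r))"
      using step_char_integral_tendsto[OF that] by (simp only: tendsto_cong)
    thus ?thesis by (simp only: tendsto_of_real_iff)
  qed
  have lim: "(\<lambda>m. r\<^sup>2 * (X r m / X 1 m)) \<longlonglongrightarrow> r\<^sup>2 * (sqrt (2 * pi / r) / sqrt (2 * pi / 1))"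
    by (intro tendsto_intros X r) auto
  have val: "r\<^sup>2 * (sqrt (2 * pi / r) / sqrt (2 * pi / 1)) = r\<^sup>2 / sqrt r"
    by (simp add: real_sqrt_divide)
  have "\<forall>\<^sub>F m in sequentially. r\<^sup>2 * (X r m / X 1 m) =
      tree_number m (defect r) / real m ^ (m - 2) * exp ((1 - r) * m)"
    using eventually_gt_at_top[of 0]
  proof eventually_elim
    case (elim m)
    have "exp ((1 - r) * m) = exp m / exp (r * m)" by (simp add: left_diff_distrib exp_diff)
    moreover have "defect 1 = 0" by (simp add: defect_def)
    ultimately show ?case using elim r by (simp add: X_def field_simps)
  qed
  from tendsto_cong[THEN iffD1, OF this lim] show ?thesis unfolding val .
qed

section \<open>Digraph notions in terms of edge sets\<close>

lemma induce_with_proj: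
  "with_proj \<lparr>pverts = V, parcs = E\<rparr> \<restriction> W = with_proj \<lparr>pverts = W, parcs = E \<inter> W \<times> W\<rparr>"
  by (auto simp: induce_subgraph_def with_proj_def)

lemma reachable_with_proj_iff:
  assumes "E \<subseteq> W \<times> W" "u \<in> W" "w \<in> W"
  shows "u \<rightarrow>\<^sup>*\<^bsub>with_proj \<lparr>pverts = W, parcs = E\<rparr>\<^esub> w \<longleftrightarrow> (u, w) \<in> E\<^sup>*"
proof
  show "u \<rightarrow>\<^sup>*\<^bsub>with_proj \<lparr>pverts = W, parcs = E\<rparr>\<^esub> w \<Longrightarrow> (u, w) \<in> E\<^sup>*"
    by (simp add: reachable_def rtrancl_on_rtranclI)
  show "(u, w) \<in> E\<^sup>* \<Longrightarrow> u \<rightarrow>\<^sup>*\<^bsub>with_proj \<lparr>pverts = W, parcs = E\<rparr>\<^esub> w"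
    unfolding reachable_def by (rule rtrancl_consistent_rtrancl_on) (use assms in auto)
qed

lemma pcas_last_in_verts: "pcas u p v \<Longrightarrow> v \<in> set (pawalk_verts u p)"
  by (induction p arbitrary: u) auto

lemma pcas_tail_in_verts: "pcas u p v \<Longrightarrow> (x, y) \<in> set p \<Longrightarrow> x \<in> set (pawalk_verts u p)"
  by (induction p arbitrary: u) auto

lemma pcas_rtrancl: "pcas u p v \<Longrightarrow> (u, v) \<in> (set p)\<^sup>*"
proof (induction p arbitrary: u)
  case (Cons e p)
  hence "(snd e, v) \<in> (set p)\<^sup>*" "fst e = u" by auto
  moreover have "(set p)\<^sup>* \<subseteq> (set (e # p))\<^sup>*" by (rule rtrancl_mono) auto
  moreover have "(fst e, snd e) \<in> set (e # p)" by simp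
  ultimately show ?case by (meson converse_rtrancl_into_rtrancl subsetD)
qed simp

lemma path_avoids_end:
  "pcas u p v \<Longrightarrow> distinct (pawalk_verts u p) \<Longrightarrow> (v, x) \<notin> set p"
proof (induction p arbitrary: u)
  case (Cons e p)
  thus ?case using pcas_last_in_verts[of "snd e" p v] by auto
qed simp

text \<open>
A path whose first edge led to its last vertex would be finished after that edge.
\<close>

lemma long_path_avoids_shortcut:
  assumes p: "pcas u p v" "distinct (pawalk_verts u p)" "2 \<le> length p"
  shows "(u, v) \<notin> set p"
proof
  assume uv: "(u, v) \<in> set p"
  obtain e f q where pe: "p = e # f # q"
    using p(3) by (cases p; cases "tl p") auto
  have "u \<notin> set (pawalk_verts (snd e) (f # q))" "fst e = u" using p pe by auto
  hence "(u, v) \<notin> set (f # q)" using pcas_tail_in_verts[of "snd e" "f # q" v] p pe by auto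
  hence "e = (u, v)" using uv pe by auto
  hence "fst f = v" "pcas (snd f) q v" "v \<notin> set (pawalk_verts (snd f) q)" using p pe by auto
  thus False using pcas_last_in_verts by metis
qed

lemma rtrancl_imp_simple_path:
  assumes "(u, v) \<in> E\<^sup>*"
  shows "\<exists>p. set p \<subseteq> E \<and> pcas u p v \<and> distinct (pawalk_verts u p)"
  using assms
proof (induction rule: converse_rtrancl_induct)
  case base
  show ?case by (intro exI[of _ "[]"]) auto
next
  case (step u x)
  then obtain p where p: "set p \<subseteq> E" "pcas x p v" "distinct (pawalk_verts x p)" by blast
  show ?case
  proof (cases "u \<in> set (pawalk_verts x p)")
    case False
    thus ?thesis using p step(1) by (intro exI[of _ "(u, x) # p"]) auto
  next
    case True
    thus ?thesis using p
    proof (induction p arbitrary: x)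
      case Nil
      thus ?case by (intro exI[of _ "[]"]) auto
    next
      case (Cons e p)
      show ?case
      proof (cases "u = fst e")
        case True
        thus ?thesis using Cons.prems by (intro exI[of _ "e # p"]) auto
      next
        case False
        thus ?thesis using Cons.prems by (intro Cons.IH[of "snd e"]) auto
      qed
    qed
  qed
qed

text \<open>
A cycle of length at least three consists of an edge and of a simple path of length at least two between its ends;
such a path contains neither orientation of the edge. Conversely, a simple path around a deleted edge closes up to a
cycle with that edge.
\<close>

lemma undirected_forest_iff:
  assumes E: "simple_on W E"
  shows "undirected_forest (with_proj \<lparr>pverts = W, parcs = E\<rparr>) \<longleftrightarrow> bridges_only E"
proof -
  have cycle: "pre_digraph.cycle (with_proj \<lparr>pverts = W, parcs = E\<rparr>) p \<longleftrightarrow>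
      (\<exists>u\<in>W. set p \<subseteq> E \<and> pcas u p u \<and> distinct (tl (pawalk_verts u p)) \<and> p \<noteq> [])" for p
    by (auto simp: pre_digraph.cycle_def pre_digraph.awalk_def cas_with_proj_eq awalk_verts_with_proj_eq)
  note s = simple_onD[OF E]
  show ?thesis
  proof
    assume forest: "undirected_forest (with_proj \<lparr>pverts = W, parcs = E\<rparr>)"
    show "bridges_only E"
      unfolding bridges_only_def
    proof (intro ballI, clarify)
      fix u v assume uv: "(u, v) \<in> E" "(u, v) \<in> (E - both_ways u v)\<^sup>*"
      obtain p where p: "set p \<subseteq> E - both_ways u v" "pcas u p v" "distinct (pawalk_verts u p)"
        using rtrancl_imp_simple_path[OF uv(2)] by blast
      have "u \<noteq> v" using s(6) uv(1) by auto
      have "2 \<le> length p"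
      proof (rule ccontr)
        assume "\<not> 2 \<le> length p"
        then consider "p = []" | e where "p = [e]" by (cases p; cases "tl p") auto
        thus False using p \<open>u \<noteq> v\<close> by cases (auto simp: both_ways_def)
      qed
      hence "pre_digraph.cycle (with_proj \<lparr>pverts = W, parcs = E\<rparr>) ((v, u) # p) \<and> 3 \<le> length ((v, u) # p)"
        unfolding cycle using p uv(1) s(4,5) by (auto intro!: bexI[of _ v])
      thus False using forest unfolding undirected_forest_def by blast
    qed
  next
    assume acyclic: "bridges_only E"
    show "undirected_forest (with_proj \<lparr>pverts = W, parcs = E\<rparr>)"
      unfolding undirected_forest_def
    proof clarify
      fix p assume "pre_digraph.cycle (with_proj \<lparr>pverts = W, parcs = E\<rparr>) p" and len: "3 \<le> length p"
      then obtain u where p: "set p \<subseteq> E" "pcas u p u" "distinct (tl (pawalk_verts u p))" "p \<noteq> []"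
        unfolding cycle by blast
      then obtain v q where q: "p = (u, v) # q" by (cases p) auto
      have path: "pcas v q u" "distinct (pawalk_verts v q)" "2 \<le> length q" using p len q by auto
      have uv: "(u, v) \<in> E" using p q by simp
      have "set q \<subseteq> E - both_ways u v"
        using path_avoids_end[OF path(1,2), of v] long_path_avoids_shortcut[OF path] p(1) q
        by (auto simp: both_ways_def)
      hence "(v, u) \<in> (E - both_ways u v)\<^sup>*" using pcas_rtrancl[OF path(1)] rtrancl_mono by blast
      hence "(u, v) \<in> (E - both_ways u v)\<^sup>*"
        using sym_rtrancl_iff[OF sym_diff_both_ways[OF s(1)]] by blast
      thus False using bridges_onlyD[OF acyclic uv] by contradiction
    qed
  qed
qed

text \<open>
Absence of cutvertices in the form in which it is used: since the graph is connected, deleting a vertex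
must leave all remaining pairs connected.
\<close>

definition biconnected :: "'a set \<Rightarrow> ('a \<times> 'a) set \<Rightarrow> bool" where
  "biconnected V E \<longleftrightarrow> 2 \<le> card V \<and> (\<forall>u\<in>V. \<forall>w\<in>V. (u, w) \<in> E\<^sup>*) \<and>
    (\<forall>x\<in>V. \<forall>u\<in>V - {x}. \<forall>w\<in>V - {x}. (u, w) \<in> (E \<inter> (V - {x}) \<times> (V - {x}))\<^sup>*)"

lemma two_connected_iff:
  assumes E: "simple_on V E"
  shows "two_connected (with_proj \<lparr>pverts = V, parcs = E\<rparr>) \<longleftrightarrow> biconnected V E"
proof -
  note s = simple_onD[OF E]
  have "symcl E = E" using s(5) by (auto simp: symcl_def)
  hence con: "Digraph_Component.connected (with_proj \<lparr>pverts = V, parcs = E\<rparr>) \<longleftrightarrow>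
      V \<noteq> {} \<and> (\<forall>u\<in>V. \<forall>w\<in>V. (u, w) \<in> E\<^sup>*)"
    using reachable_with_proj_iff[OF s(7)] by (simp add: connected_conv reachable_def)
  have cut: "cutvertex (with_proj \<lparr>pverts = V, parcs = E\<rparr>) x \<longleftrightarrow> x \<in> V \<and>
      (\<exists>u\<in>V - {x}. \<exists>w\<in>V - {x}. (u, w) \<in> E\<^sup>* \<and> (u, w) \<notin> (E \<inter> (V - {x}) \<times> (V - {x}))\<^sup>*)" for x
    unfolding cutvertex_def induce_with_proj
    using reachable_with_proj_iff[OF s(7)]
      reachable_with_proj_iff[of "E \<inter> (V - {x}) \<times> (V - {x})" "V - {x}"] by simp
  have "2 \<le> card V \<Longrightarrow> V \<noteq> {}" by auto
  thus ?thesis unfolding two_connected_def con cut biconnected_def with_proj_simps pair_pre_digraph.simps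
    by blast
qed

definition apex_edges :: "nat \<Rightarrow> 'a set \<Rightarrow> ('a \<times> 'a) set set" where
  "apex_edges k V = {E. simple_on V E \<and>
    (\<exists>S\<subseteq>V. card S \<le> k \<and> bridges_only (E \<inter> (V - S) \<times> (V - S)))}"

lemma labelled_graphs_iff:
  "\<lparr>pverts = V, parcs = E\<rparr> \<in> labelled_graphs n \<longleftrightarrow> V = {1..n} \<and> simple_on {1..n} E"
proof
  assume "\<lparr>pverts = V, parcs = E\<rparr> \<in> labelled_graphs n"
  hence g: "pair_graph \<lparr>pverts = V, parcs = E\<rparr>" and V: "V = {1..n}" by (auto simp: labelled_graphs_def)
  interpret pair_graph "\<lparr>pverts = V, parcs = E\<rparr>" by (rule g)
  have "E \<subseteq> V \<times> V" using arc_fst_in_verts arc_snd_in_verts by fastforce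
  moreover have "sym E" using pair_sym_arcs by (simp add: symmetric_def)
  moreover have "irrefl E" using pair_no_loops by (fastforce simp: irrefl_def)
  ultimately show "V = {1..n} \<and> simple_on {1..n} E" using V by (simp add: simple_on_def)
next
  assume a: "V = {1..n} \<and> simple_on {1..n} E"
  hence "finite E" using simple_on_finite by blast
  hence "pair_graph \<lparr>pverts = V, parcs = E\<rparr>"
    using a by unfold_locales (auto simp: simple_on_def symmetric_def irrefl_def)
  thus "\<lparr>pverts = V, parcs = E\<rparr> \<in> labelled_graphs n" using a by (simp add: labelled_graphs_def)
qed

lemma simple_on_induce: "simple_on V E \<Longrightarrow> simple_on W (E \<inter> W \<times> W)"
  by (auto simp: simple_on_def sym_def irrefl_def)

lemma apex_forest_iff:
  assumes E: "simple_on V E" and V: "finite V"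
  shows "apex_forest k (with_proj \<lparr>pverts = V, parcs = E\<rparr>) \<longleftrightarrow> E \<in> apex_edges k V"
  using E V finite_subset[of _ V] undirected_forest_iff[OF simple_on_induce[OF E]]
  by (auto simp: apex_forest_def apex_edges_def induce_with_proj)

lemma apex_forests_eq:
  "apex_forests k n = (\<lambda>E. \<lparr>pverts = {1..n}, parcs = E\<rparr>) ` apex_edges k {1..n}"
proof (intro equalityI subsetI)
  fix G assume G: "G \<in> apex_forests k n"
  obtain V E where VE: "G = \<lparr>pverts = V, parcs = E\<rparr>" by (cases G) auto
  hence "V = {1..n}" "simple_on {1..n} E" using G labelled_graphs_iff by (auto simp: apex_forests_def)
  thus "G \<in> (\<lambda>E. \<lparr>pverts = {1..n}, parcs = E\<rparr>) ` apex_edges k {1..n}"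
    using G VE apex_forest_iff[of "{1..n}" E k] by (auto simp: apex_forests_def)
next
  fix G assume "G \<in> (\<lambda>E. \<lparr>pverts = {1..n}, parcs = E\<rparr>) ` apex_edges k {1..n}"
  then obtain E where E: "G = \<lparr>pverts = {1..n}, parcs = E\<rparr>" "E \<in> apex_edges k {1..n}" by auto
  hence "simple_on {1..n} E" by (auto simp: apex_edges_def)
  thus "G \<in> apex_forests k n"
    using E apex_forest_iff[of "{1..n}" E k] labelled_graphs_iff by (auto simp: apex_forests_def)
qed

lemma prob_two_connected_eq:
  "prob_two_connected k n =
    card {E \<in> apex_edges k {1..n}. biconnected {1..n} E} / card (apex_edges k {1..n})"
proof -
  let ?g = "\<lambda>E. \<lparr>pverts = {1..n}, parcs = E\<rparr> :: nat pair_pre_digraph"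
  have inj: "inj_on ?g A" for A by (auto simp: inj_on_def)
  have "apex_forests k n \<inter> {G. two_connected (with_proj G)} =
      ?g ` {E \<in> apex_edges k {1..n}. biconnected {1..n} E}"
  proof -
    have iff: "two_connected (with_proj (?g E)) \<longleftrightarrow> biconnected {1..n} E"
      if "E \<in> apex_edges k {1..n}" for E
      using that by (intro two_connected_iff) (simp add: apex_edges_def)
    show ?thesis unfolding apex_forests_eq using iff by blast
  qed
  hence "card (apex_forests k n \<inter> {G. two_connected (with_proj G)}) =
      card {E \<in> apex_edges k {1..n}. biconnected {1..n} E}"
    by (simp only: card_image[OF inj])
  moreover have "card (apex_forests k n) = card (apex_edges k {1..n})"
    unfolding apex_forests_eq by (rule card_image[OF inj])
  ultimately show ?thesis
    unfolding prob_two_connected_def random_apex_forest_def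
    using measure_pmf_of_set[OF apex_forests_nonempty finite_apex_forests] by simp
qed

section \<open>Hubs of trees\<close>

text \<open>
Each component of a tree with one vertex removed contains a leaf of the tree. This is proved by induction,
stripping off a leaf \<open>y\<^sub>0\<close> with neighbour \<open>y\<close>: a leaf of the smaller tree remains a leaf unless it is \<open>y\<close>, and
then \<open>y\<^sub>0\<close> serves instead. If \<open>y\<^sub>0\<close> itself is the removed vertex, the induction hypothesis is applied with
\<open>y\<close> as the vertex to avoid.
\<close>

lemma tree_reaches_leaf_avoiding:
  assumes "finite W" "2 \<le> card W" "T \<in> labelled_trees W" "v \<in> W" "v \<noteq> x" "x \<in> W"
  shows "\<exists>l\<in>low_degree W T. l \<noteq> x \<and> (v, l) \<in> (T \<inter> (W - {x}) \<times> (W - {x}))\<^sup>*"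
  using assms
proof (induction "card W" arbitrary: W T v x rule: less_induct)
  case less
  note W = less.prems(1,2) and T = less.prems(3) and v = less.prems(4,5) and x = less.prems(6)
  note s = simple_onD[OF treesD(1)[OF T]]
  show ?case
  proof (cases "card W = 2")
    case True
    have "{v, x} = W" using v x W True by (intro card_seteq) auto
    hence "T `` {v} \<subseteq> {x}" using s(4,6) by auto
    hence "card (T `` {v}) \<le> card {x}" by (intro card_mono) auto
    hence "v \<in> low_degree W T" using v by (simp add: low_degree_def)
    thus ?thesis using v by blast
  next
    case False
    have "W \<noteq> {}" using v by auto
    then obtain y0 where y0: "y0 \<in> low_degree W T" using tree_low_nonempty[OF W(1) _ T] by blast
    then obtain y where y: "y \<in> W" "y \<noteq> y0" "T `` {y0} = {y}"
      using low_tree_neighbour[OF W T] by metis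
    define W' where "W' = W - {y0}"
    define T' where "T' = T - both_ways y0 y"
    have y0W: "y0 \<in> W" using y0 by (simp add: low_degree_def)
    have T': "T' \<in> labelled_trees W'" unfolding T'_def W'_def by (rule trees_remove_leaf[OF T y(3)])
    have W': "finite W'" "2 \<le> card W'" "card W' < card W" using W False y0W by (auto simp: W'_def)
    have T'sub: "T' \<subseteq> T \<inter> W' \<times> W'"
      using simple_onD(7)[OF treesD(1)[OF T']] by (auto simp: T'_def)
    have low': "l \<in> low_degree W T" if "l \<in> low_degree W' T'" "l \<noteq> y" for l
    proof -
      have "l \<noteq> y0" "l \<in> W" using that by (auto simp: low_degree_def W'_def)
      hence "T `` {l} = T' `` {l}" using that by (auto simp: T'_def both_ways_def)
      thus ?thesis using that \<open>l \<in> W\<close> by (simp add: low_degree_def)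
    qed
    have edge: "(y, y0) \<in> T" using y(3) s(5) by blast
    consider "y0 = x" | "y0 \<noteq> x" "v = y0" | "y0 \<noteq> x" "v \<noteq> y0" by blast
    thus ?thesis
    proof cases
      case 1
      obtain v' where v': "v' \<in> W'" "v' \<noteq> y"
      proof -
        have "\<not> W' \<subseteq> {y}" using W' card_mono[of "{y}" W'] by auto
        thus thesis using that by blast
      qed
      have yW': "y \<in> W'" using y by (simp add: W'_def)
      obtain l where l: "l \<in> low_degree W' T'" "l \<noteq> y"
        using less.hyps[OF W'(3,1,2) T' v' yW'] by blast
      have "v \<in> W'" using v 1 by (simp add: W'_def)
      moreover have "l \<in> W'" using l by (simp add: low_degree_def)
      ultimately have "(v, l) \<in> T'\<^sup>*" by (rule treesD(3)[OF T'])
      moreover have "T'\<^sup>* \<subseteq> (T \<inter> (W - {x}) \<times> (W - {x}))\<^sup>*"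
        using T'sub 1 by (intro rtrancl_mono) (auto simp: W'_def)
      ultimately show ?thesis using low'[OF l] \<open>l \<in> W'\<close> 1 by (auto simp: W'_def)
    next
      case 2
      thus ?thesis using y0 by blast
    next
      case 3
      hence "v \<in> W'" "x \<in> W'" using v x by (auto simp: W'_def)
      then obtain l where l: "l \<in> low_degree W' T'" "l \<noteq> x" "(v, l) \<in> (T' \<inter> (W' - {x}) \<times> (W' - {x}))\<^sup>*"
        using less.hyps[OF W'(3,1,2) T' _ v(2)] by blast
      have "(T' \<inter> (W' - {x}) \<times> (W' - {x}))\<^sup>* \<subseteq> (T \<inter> (W - {x}) \<times> (W - {x}))\<^sup>*"
        using T'sub by (intro rtrancl_mono) (auto simp: W'_def)
      hence path: "(v, l) \<in> (T \<inter> (W - {x}) \<times> (W - {x}))\<^sup>*" using l(3) by blast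
      show ?thesis
      proof (cases "l = y")
        case False thus ?thesis using low'[OF l(1)] l(2) path by blast
      next
        case True
        hence "(l, y0) \<in> T \<inter> (W - {x}) \<times> (W - {x})" using edge l(2) y y0W 3 by auto
        hence "(v, y0) \<in> (T \<inter> (W - {x}) \<times> (W - {x}))\<^sup>*" using path by (rule rtrancl_into_rtrancl[rotated])
        thus ?thesis using y0 3 by blast
      qed
    qed
  qed
qed

text \<open>
Such a set arises as the vertex set of a matching with \<open>k + 1\<close> edges, of which \<open>k\<close> removed vertices can
destroy at most \<open>k\<close>.
\<close>

definition resilient :: "nat \<Rightarrow> ('a \<times> 'a) set \<Rightarrow> 'a set \<Rightarrow> bool" where
  "resilient k T U \<longleftrightarrow> U \<subseteq> Domain T \<and> finite U \<and> card U \<le> 2 * (k + 1) \<and>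
     (\<forall>R. finite R \<and> card R \<le> k \<longrightarrow> (\<exists>(a, b)\<in>T. a \<in> U - R \<and> b \<in> U - R))"

text \<open>
Disjoint edges are chosen greedily. As long as at most \<open>k\<close> of them have been chosen, their at most \<open>2 k\<close> ends form no
cover, so another disjoint edge exists.
\<close>

lemma resilient_or_small_cover:
  assumes sym: "sym T"
  shows "(\<exists>U. resilient k T U) \<or>
    (\<exists>C\<subseteq>Domain T. finite C \<and> card C \<le> 2 * k \<and> (\<forall>(a, b)\<in>T. a \<in> C \<or> b \<in> C))"
proof (rule ccontr)
  assume neg: "\<not> ?thesis"
  have edge: "\<exists>(a, b)\<in>T. a \<notin> C \<and> b \<notin> C" if "C \<subseteq> Domain T" "finite C" "card C \<le> 2 * k" for C
    using neg that by blast
  have "\<exists>U\<subseteq>Domain T. finite U \<and> card U \<le> 2 * j \<and>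
      (\<forall>R. finite R \<and> card R < j \<longrightarrow> (\<exists>(a, b)\<in>T. a \<in> U - R \<and> b \<in> U - R))" if "j \<le> k + 1" for j
    using that
  proof (induction j)
    case 0
    show ?case by (intro exI[of _ "{}"]) auto
  next
    case (Suc j)
    then obtain U where U: "U \<subseteq> Domain T" "finite U" "card U \<le> 2 * j"
      "\<And>R. finite R \<and> card R < j \<Longrightarrow> \<exists>(a, b)\<in>T. a \<in> U - R \<and> b \<in> U - R" by auto
    have "card U \<le> 2 * k" using U(3) Suc.prems by simp
    then obtain a b where ab: "(a, b) \<in> T" "a \<notin> U" "b \<notin> U" using edge[OF U(1,2)] by blast
    let ?U = "insert a (insert b U)"
    have "\<exists>(c, d)\<in>T. c \<in> ?U - R \<and> d \<in> ?U - R" if R: "finite R" "card R < Suc j" for R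
    proof (cases "a \<in> R \<or> b \<in> R")
      case False thus ?thesis using ab by blast
    next
      case True
      have "R - {a, b} \<subset> R" using True by blast
      hence "card (R - {a, b}) < card R" using R by (intro psubset_card_mono)
      hence "finite (R - {a, b}) \<and> card (R - {a, b}) < j" using R by simp
      then obtain c d where cd: "(c, d) \<in> T" "c \<in> U - (R - {a, b})" "d \<in> U - (R - {a, b})"
        using U(4) by blast
      moreover have "U - (R - {a, b}) = U - R" using ab by auto
      ultimately show ?thesis by auto
    qed
    moreover have "card ?U \<le> 2 * Suc j"
      using U(2,3) by (simp add: card_insert_if)
    moreover have "?U \<subseteq> Domain T" using U(1) ab(1) sym by (auto dest: symE)
    ultimately show ?case using U(2) by (intro exI[of _ ?U]) auto
  qed
  from this[of "k + 1"] have "\<exists>U. resilient k T U"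
    unfolding resilient_def by (auto simp: less_Suc_eq_le)
  thus False using neg by blast
qed

definition hub :: "nat \<Rightarrow> ('a \<times> 'a) set \<Rightarrow> 'a set" where
  "hub k T = (SOME U. resilient k T U)"

definition resilient_trees :: "nat \<Rightarrow> 'a set \<Rightarrow> ('a \<times> 'a) set set" where
  "resilient_trees k W = {T \<in> labelled_trees W. \<exists>U. resilient k T U}"

lemma resilient_hub: "T \<in> resilient_trees k W \<Longrightarrow> resilient k T (hub k T)"
  unfolding resilient_trees_def hub_def by (auto intro: someI)

text \<open>
A tree without a resilient set has a vertex cover \<open>C\<close> with at most \<open>2 k\<close> vertices and is determined by \<open>C\<close> and by its
edges that start in \<open>C\<close>. This leaves exponentially many trees only, a negligible part of \<open>m\<^bsup>m - 2\<^esup>\<close>.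
\<close>

lemma card_non_resilient_trees:
  assumes W: "finite W"
  shows "card (labelled_trees W - resilient_trees k W) \<le> 2 ^ ((2 * k + 1) * card W)"
proof -
  let ?B = "\<Union>C\<in>{C \<in> Pow W. card C \<le> 2 * k}. (\<lambda>R. R \<union> R\<inverse>) ` Pow (C \<times> W)"
  have fin: "finite C" if "C \<in> Pow W" for C using that W finite_subset by auto
  have "labelled_trees W - resilient_trees k W \<subseteq> ?B"
  proof
    fix T assume "T \<in> labelled_trees W - resilient_trees k W"
    hence T: "T \<in> labelled_trees W" "\<not> (\<exists>U. resilient k T U)" by (auto simp: resilient_trees_def)
    note s = simple_onD[OF treesD(1)[OF T(1)]]
    obtain C where C: "C \<subseteq> Domain T" "card C \<le> 2 * k" "\<forall>(a, b)\<in>T. a \<in> C \<or> b \<in> C"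
      using resilient_or_small_cover[OF s(1), of k] T(2) by blast
    let ?R = "T \<inter> C \<times> W"
    have "T = ?R \<union> ?R\<inverse>" using C(3) s(3,4,5) by auto
    moreover have "C \<subseteq> W" using C(1) s(3) by auto
    ultimately show "T \<in> ?B" using C(2) by blast
  qed
  hence "card (labelled_trees W - resilient_trees k W) \<le> card ?B"
    using W fin by (intro card_mono finite_UN_I) auto
  also have "\<dots> \<le> (\<Sum>C\<in>{C \<in> Pow W. card C \<le> 2 * k}. card ((\<lambda>R. R \<union> R\<inverse>) ` Pow (C \<times> W)))"
    using W by (intro card_UN_le) auto
  also have "\<dots> \<le> (\<Sum>C\<in>{C \<in> Pow W. card C \<le> 2 * k}. 2 ^ (2 * k * card W))"
  proof (rule sum_mono)
    fix C assume C: "C \<in> {C \<in> Pow W. card C \<le> 2 * k}"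
    have "card ((\<lambda>R. R \<union> R\<inverse>) ` Pow (C \<times> W)) \<le> card (Pow (C \<times> W))"
      using C fin W by (intro card_image_le) auto
    also have "\<dots> = 2 ^ (card C * card W)"
      using C fin W by (simp add: card_Pow card_cartesian_product)
    also have "\<dots> \<le> 2 ^ (2 * k * card W)" using C by (intro power_increasing) auto
    finally show "card ((\<lambda>R. R \<union> R\<inverse>) ` Pow (C \<times> W)) \<le> 2 ^ (2 * k * card W)" .
  qed
  also have "\<dots> \<le> (\<Sum>C\<in>Pow W. 2 ^ (2 * k * card W))"
    using W by (intro sum_mono2) auto
  also have "\<dots> = 2 ^ ((2 * k + 1) * card W)"
    using W by (simp add: card_Pow power_add algebra_simps)
  finally show ?thesis .
qed

lemma resilient_tree_weight_ge:
  fixes w :: real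
  assumes W: "finite W" and w: "0 \<le> w" "w \<le> 1"
  shows "(\<Sum>T\<in>resilient_trees k W. w ^ card (low_degree W T)) \<ge> tree_weight W w - 2 ^ ((2 * k + 1) * card W)"
proof -
  let ?N = "labelled_trees W - resilient_trees k W"
  have "tree_weight W w = (\<Sum>T\<in>?N. w ^ card (low_degree W T)) + (\<Sum>T\<in>resilient_trees k W. w ^ card (low_degree W T))"
    unfolding tree_weight_def using finite_trees[OF W]
    by (intro sum.subset_diff) (auto simp: resilient_trees_def)
  moreover have "(\<Sum>T\<in>?N. w ^ card (low_degree W T)) \<le> (\<Sum>T\<in>?N. 1)"
    using w by (intro sum_mono power_le_one) auto
  moreover have "(\<Sum>T\<in>?N. 1 :: real) \<le> 2 ^ ((2 * k + 1) * card W)"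
    using card_non_resilient_trees[OF W, of k] by (simp flip: of_nat_le_iff)
  ultimately show ?thesis by linarith
qed

section \<open>Graphs assembled from a forest and an apex set: upper bound\<close>

text \<open>
\<open>F\<close> is the forest on \<open>W\<close>, \<open>X\<close> the graph on the apex set, and \<open>f v\<close> the set of apex vertices linked
to \<open>v\<close>.
\<close>

definition assemble ::
  "'a set \<Rightarrow> ('a \<times> 'a) set \<Rightarrow> ('a \<times> 'a) set \<Rightarrow> ('a \<Rightarrow> 'a set) \<Rightarrow> ('a \<times> 'a) set" where
  "assemble W F X f = F \<union> X \<union> {(s, v). v \<in> W \<and> s \<in> f v} \<union> {(v, s). v \<in> W \<and> s \<in> f v}"

text \<open>
The flag \<open>Q\<close> distinguishes the two classes that are counted: \<open>2\<close>-connected graphs (\<open>Q = True\<close>), where vertices of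
low degree need a link, and arbitrary \<open>k\<close>-apex forests.
\<close>

definition must_link :: "bool \<Rightarrow> 'a set \<Rightarrow> ('a \<times> 'a) set \<Rightarrow> 'a set" where
  "must_link Q W F = (if Q then low_degree W F else {})"

definition links :: "bool \<Rightarrow> 'a set \<Rightarrow> 'a set \<Rightarrow> ('a \<times> 'a) set \<Rightarrow> 'a \<Rightarrow> 'a set set" where
  "links Q S W F v = (if v \<in> must_link Q W F then Pow S - {{}} else Pow S)"

text \<open>
The fraction of the \<open>2\<^sup>k\<close> link sets that is admissible at a vertex of low degree.
\<close>

definition leaf_factor :: "bool \<Rightarrow> nat \<Rightarrow> real" where
  "leaf_factor Q k = (if Q then 1 - 1 / 2 ^ k else 1)"

lemma leaf_factor_bounds: "0 \<le> leaf_factor Q k" "leaf_factor Q k \<le> 1"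
  by (auto simp: leaf_factor_def)

lemma card_links:
  assumes "finite S"
  shows "real (card (links Q S W F v)) = 2 ^ card S * (if v \<in> low_degree W F then leaf_factor Q (card S) else 1)"
proof -
  have "card (Pow S - {{}}) = 2 ^ card S - 1" using assms by (simp add: card_Diff_subset card_Pow)
  moreover have "(1::nat) \<le> 2 ^ card S" by simp
  moreover have "card (Pow S) = 2 ^ card S" using assms by (rule card_Pow)
  ultimately show ?thesis
    by (auto simp: links_def must_link_def leaf_factor_def card_Pow of_nat_diff algebra_simps)
qed

lemma prod_if_mem:
  fixes a b :: real
  assumes "finite W" "L \<subseteq> W"
  shows "(\<Prod>v\<in>W. b * (if v \<in> L then a else 1)) = b ^ card W * a ^ card L"
proof -
  have "W \<inter> L = L" using assms by auto
  thus ?thesis using assms by (simp add: prod.distrib prod.If_cases)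
qed

lemma card_PiE_links:
  assumes W: "finite W" and S: "finite S"
  shows "real (card (PiE W (links Q S W F))) = 2 ^ (card S * card W) * leaf_factor Q (card S) ^ card (low_degree W F)"
  using prod_if_mem[OF W low_subset] by (simp add: card_PiE[OF W] card_links[OF S] power_mult)

text \<open>
Every graph of the family is assembled from an apex set, a forest, admissible links and a graph on the apex
set. Summed over the links, a forest has its weight for the leaf factor, up to the total number
\<open>2\<^bsup>k (n - k)\<^esup>\<close> of link patterns, so that \<open>forest_weight_le_tree_weight\<close> applies. The at most \<open>2\<^bsup>k\<^sup>2\<^esup>\<close> graphs
on the apex set only cost a constant.
\<close>

lemma card_apex_structures_le:
  assumes V: "finite V" and k: "k < card V"
    and \<G>: "\<And>E. E \<in> \<G> \<Longrightarrow> simple_on V E \<and> (\<exists>S\<subseteq>V. card S = k \<and> bridges_only (E \<inter> (V - S) \<times> (V - S)) \<and>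
        (\<forall>v\<in>must_link Q (V - S) (E \<inter> (V - S) \<times> (V - S)). \<exists>s\<in>S. (s, v) \<in> E))"
    and t: "\<And>W. W \<subseteq> V \<Longrightarrow> card W = card V - k \<Longrightarrow> tree_weight W (leaf_factor Q k) = t"
  shows "card \<G> \<le> (card V choose k) * (2 ^ k\<^sup>2 * 2 ^ (k * (card V - k)) * exp 2 * t)"
proof -
  define m where "m = card V - k"
  define \<S> where "\<S> = {S. S \<subseteq> V \<and> card S = k}"
  define P where "P S F = PiE (V - S) (links Q S (V - S) F) \<times> Pow (S \<times> S)" for S F
  define B where "B S = (\<Union>F\<in>labelled_forests (V - S). (\<lambda>(f, X). assemble (V - S) F X f) ` P S F)" for S
  have fin\<S>: "finite \<S>" using V by (auto simp: \<S>_def)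
  have finS: "finite S" "card (V - S) = m" if "S \<in> \<S>" for S
    using that V finite_subset[of S V] by (auto simp: \<S>_def m_def card_Diff_subset)
  have finP: "finite (P S F)" if "S \<in> \<S>" for S F
    unfolding P_def using V finS[OF that] by (intro finite_cartesian_product finite_PiE) (auto simp: links_def)
  have "\<G> \<subseteq> (\<Union>S\<in>\<S>. B S)"
  proof
    fix E assume "E \<in> \<G>"
    then obtain S where E: "simple_on V E" and S: "S \<subseteq> V" "card S = k"
      and F: "bridges_only (E \<inter> (V - S) \<times> (V - S))"
      and L: "\<forall>v\<in>must_link Q (V - S) (E \<inter> (V - S) \<times> (V - S)). \<exists>s\<in>S. (s, v) \<in> E"
      using \<G> by metis
    define W where "W = V - S"
    define f where "f = (\<lambda>v\<in>W. {s \<in> S. (s, v) \<in> E})"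
    note s = simple_onD[OF E]
    have "E = assemble W (E \<inter> W \<times> W) (E \<inter> S \<times> S) f"
      using s(3,4,5) by (auto simp: assemble_def f_def W_def)
    moreover have "E \<inter> W \<times> W \<in> labelled_forests W"
      using F simple_on_induce[OF E] by (auto simp: labelled_forests_def W_def)
    moreover have "(f, E \<inter> S \<times> S) \<in> P S (E \<inter> W \<times> W)"
      by (auto simp: P_def links_def f_def W_def) (use L in blast)
    ultimately have "E \<in> B S" unfolding B_def W_def by force
    thus "E \<in> (\<Union>S\<in>\<S>. B S)" using S by (auto simp: \<S>_def)
  qed
  moreover have finB: "finite (B S)" if "S \<in> \<S>" for S
    unfolding B_def by (intro finite_UN_I finite_forests finite_imageI finP that) (use V in simp)
  ultimately have "card \<G> \<le> card (\<Union>S\<in>\<S>. B S)" using fin\<S> by (intro card_mono) auto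
  also have "\<dots> \<le> (\<Sum>S\<in>\<S>. card (B S))" using fin\<S> by (rule card_UN_le)
  finally have "real (card \<G>) \<le> (\<Sum>S\<in>\<S>. real (card (B S)))" by (simp flip: of_nat_sum)
  also have "\<dots> \<le> (\<Sum>S\<in>\<S>. 2 ^ k\<^sup>2 * 2 ^ (k * m) * exp 2 * t)"
  proof (rule sum_mono)
    fix S assume S: "S \<in> \<S>"
    have Sk: "S \<subseteq> V" "card S = k" using S by (auto simp: \<S>_def)
    note fS = finS[OF S]
    have "card (B S) \<le> (\<Sum>F\<in>labelled_forests (V - S). card ((\<lambda>(f, X). assemble (V - S) F X f) ` P S F))"
      unfolding B_def using V finite_forests by (intro card_UN_le) auto
    also have "\<dots> \<le> (\<Sum>F\<in>labelled_forests (V - S). card (P S F))"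
      by (intro sum_mono card_image_le finP S)
    finally have "real (card (B S)) \<le> (\<Sum>F\<in>labelled_forests (V - S). real (card (P S F)))"
      by (simp flip: of_nat_sum)
    also have "\<dots> = (\<Sum>F\<in>labelled_forests (V - S). 2 ^ k\<^sup>2 * 2 ^ (k * m) * leaf_factor Q k ^ card (low_degree (V - S) F))"
    proof (rule sum.cong)
      fix F
      have "real (card (P S F)) = real (card (PiE (V - S) (links Q S (V - S) F))) * 2 ^ k\<^sup>2"
        using fS Sk by (simp add: P_def card_cartesian_product card_Pow power2_eq_square)
      thus "real (card (P S F)) = 2 ^ k\<^sup>2 * 2 ^ (k * m) * leaf_factor Q k ^ card (low_degree (V - S) F)"
        using card_PiE_links[where W = "V - S" and Q = Q and F = F, OF finite_Diff[OF V] fS(1)]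
        unfolding fS(2) Sk(2) by (simp only: mult_ac)
    qed simp
    also have "\<dots> = 2 ^ k\<^sup>2 * 2 ^ (k * m) * (\<Sum>F\<in>labelled_forests (V - S). leaf_factor Q k ^ card (low_degree (V - S) F))"
      by (simp add: sum_distrib_left)
    also have "\<dots> \<le> 2 ^ k\<^sup>2 * 2 ^ (k * m) * (exp 2 * tree_weight (V - S) (leaf_factor Q k))"
    proof (intro mult_left_mono forest_weight_le_tree_weight leaf_factor_bounds)
      show "V - S \<noteq> {}" using fS(2) k unfolding m_def by (metis card.empty less_irrefl zero_less_diff)
    qed (use V in auto)
    also have "tree_weight (V - S) (leaf_factor Q k) = t"
      using fS(2) by (intro t) (auto simp: m_def)
    finally show "real (card (B S)) \<le> 2 ^ k\<^sup>2 * 2 ^ (k * m) * exp 2 * t" by (simp add: mult.assoc)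
  qed
  also have "\<dots> = (card V choose k) * (2 ^ k\<^sup>2 * 2 ^ (k * m) * exp 2 * t)"
    unfolding \<S>_def using n_subsets[OF V, of k] by simp
  finally show ?thesis by (simp add: m_def)
qed

section \<open>Graphs assembled from a tree and an apex set: lower bound\<close>

text \<open>
All vertices of the hub are linked to the whole apex set. This identifies the apex set and keeps it connected.
\<close>

definition hub_links :: "bool \<Rightarrow> nat \<Rightarrow> 'a set \<Rightarrow> 'a set \<Rightarrow> ('a \<times> 'a) set \<Rightarrow> 'a \<Rightarrow> 'a set set" where
  "hub_links Q k S W T v = (if v \<in> hub k T then {S} else links Q S W T v)"

lemma hub_links_subset: "B \<in> hub_links Q k S W T v \<Longrightarrow> B \<subseteq> S"
  by (auto simp: hub_links_def links_def split: if_splits)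

text \<open>
At each of the at most \<open>2 (k + 1)\<close> vertices of the hub, fixing the link set divides the number of choices by at most \<open>2\<^sup>k\<close>.
\<close>

lemma card_PiE_hub_links:
  assumes W: "finite W" and S: "finite S" "card S = k" and T: "T \<in> resilient_trees k W"
  shows "real (card (PiE W (hub_links Q k S W T))) \<ge>
    2 ^ (k * card W) * leaf_factor Q k ^ card (low_degree W T) / 2 ^ (2 * k * (k + 1))"
proof -
  let ?U = "hub k T" and ?w = "leaf_factor Q k"
  have U: "?U \<subseteq> Domain T" "card ?U \<le> 2 * (k + 1)"
    using resilient_hub[OF T] by (auto simp: resilient_def)
  have TW: "T \<subseteq> W \<times> W" using T simple_onD(7)[OF treesD(1)] by (auto simp: resilient_trees_def)
  have UW: "?U \<subseteq> W" using U TW by auto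
  have "2 ^ (k * card W) * ?w ^ card (low_degree W T) / 2 ^ (2 * k * (k + 1)) =
      2 ^ (k * card W) * ?w ^ card (low_degree W T) * (1 / 2 ^ k) ^ (2 * (k + 1))"
  proof -
    have "(1 / 2 ^ k :: real) ^ (2 * (k + 1)) = 1 / 2 ^ (2 * k * (k + 1))"
      by (simp only: power_one_over power_mult[symmetric] mult_ac)
    thus ?thesis by simp
  qed
  also have "\<dots> \<le> 2 ^ (k * card W) * ?w ^ card (low_degree W T) * (1 / 2 ^ k) ^ card ?U"
    using U(2) leaf_factor_bounds[of Q k] by (intro mult_left_mono power_decreasing) auto
  also have "\<dots> = (\<Prod>v\<in>W. 2 ^ k * (if v \<in> low_degree W T then ?w else 1)) * (\<Prod>v\<in>W. 1 * (if v \<in> ?U then 1 / 2 ^ k else 1))"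
    unfolding prod_if_mem[OF W low_subset] prod_if_mem[OF W UW] by (simp add: power_mult)
  also have "\<dots> = (\<Prod>v\<in>W. 2 ^ k * (if v \<in> low_degree W T then ?w else 1) * (1 * (if v \<in> ?U then 1 / 2 ^ k else 1)))"
    by (rule prod.distrib[symmetric])
  also have "\<dots> \<le> (\<Prod>v\<in>W. real (card (hub_links Q k S W T v)))"
  proof (rule prod_mono, intro conjI)
    fix v
    show "0 \<le> 2 ^ k * (if v \<in> low_degree W T then ?w else 1) * (1 * (if v \<in> ?U then 1 / 2 ^ k else 1))"
      using leaf_factor_bounds[of Q k] by auto
    show "2 ^ k * (if v \<in> low_degree W T then ?w else 1) * (1 * (if v \<in> ?U then 1 / 2 ^ k else 1))
        \<le> real (card (hub_links Q k S W T v))"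
      using leaf_factor_bounds[of Q k] card_links[OF S(1), of Q W T v] S(2)
      by (auto simp: hub_links_def)
  qed
  also have "\<dots> = real (card (PiE W (hub_links Q k S W T)))" by (simp add: card_PiE[OF W])
  finally show ?thesis .
qed

lemma assemble_restrict:
  assumes "T \<subseteq> W \<times> W" "S \<inter> W = {}" "\<And>v. v \<in> W \<Longrightarrow> f v \<subseteq> S"
  shows "assemble W T {} f \<inter> W \<times> W = T"
    and "\<And>s v. s \<in> S \<Longrightarrow> v \<in> W \<Longrightarrow> (s, v) \<in> assemble W T {} f \<longleftrightarrow> s \<in> f v"
    and "\<And>s v. s \<in> S \<Longrightarrow> v \<in> W \<Longrightarrow> (v, s) \<in> assemble W T {} f \<longleftrightarrow> s \<in> f v"
  using assms by (auto simp: assemble_def)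

lemma simple_on_assemble:
  assumes "simple_on W T" "S \<inter> W = {}" "\<And>v. v \<in> W \<Longrightarrow> f v \<subseteq> S" "V = S \<union> W"
  shows "simple_on V (assemble W T {} f)"
  using assms by (auto simp: simple_on_def assemble_def sym_def irrefl_def)

lemma triangle_not_bridges_only:
  assumes "simple_on V E" "(a, b) \<in> E" "(a, s) \<in> E" "(s, b) \<in> E"
  shows "\<not> bridges_only E"
proof
  assume "bridges_only E"
  hence "(a, b) \<notin> (E - both_ways a b)\<^sup>*" using assms by (intro bridges_onlyD)
  moreover have "(a, s) \<in> E - both_ways a b" "(s, b) \<in> E - both_ways a b"
    using assms simple_onD(6)[OF assms(1)] by (auto simp: both_ways_def)
  ultimately show False by (meson converse_rtrancl_into_rtrancl r_into_rtrancl)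
qed

text \<open>
Suppose that \<open>s\<close> lies in \<open>S\<close> but not in \<open>S'\<close>. Resilience yields a tree edge \<open>ab\<close> inside the hub that avoids \<open>S'\<close>, and
\<open>s\<close> is linked to both ends; so the triangle \<open>s a b\<close> survives the deletion of \<open>S'\<close>.
\<close>

lemma apex_set_unique:
  assumes V: "finite V" and S: "S \<subseteq> V" "card S = k" and S': "S' \<subseteq> V" "card S' = k"
    and T: "T \<in> resilient_trees k (V - S)" and T': "bridges_only T'" "simple_on (V - S') T'"
    and f: "\<And>v. v \<in> hub k T \<Longrightarrow> f v = S" and f': "\<And>v. v \<in> V - S' \<Longrightarrow> f' v \<subseteq> S'"
    and eq: "assemble (V - S) T {} f = assemble (V - S') T' {} f'"
  shows "S = S'"
proof -
  have fin: "finite S" "finite S'" using V S S' finite_subset by auto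
  have "S \<subseteq> S'"
  proof
    fix s assume s: "s \<in> S"
    show "s \<in> S'"
    proof (rule ccontr)
      assume sS': "s \<notin> S'"
      let ?U = "hub k T" and ?E = "assemble (V - S') T' {} f'"
      have U: "?U \<subseteq> Domain T" and
        res: "\<And>R. finite R \<Longrightarrow> card R \<le> k \<Longrightarrow> \<exists>(a, b)\<in>T. a \<in> ?U - R \<and> b \<in> ?U - R"
        using resilient_hub[OF T] unfolding resilient_def by blast+
      have TW: "T \<subseteq> (V - S) \<times> (V - S)"
        using T simple_onD(7)[OF treesD(1)] by (auto simp: resilient_trees_def)
      obtain a b where ab: "(a, b) \<in> T" "a \<in> ?U - S'" "b \<in> ?U - S'"
        using res[OF fin(2)] S'(2) by auto
      have abV: "a \<in> V - S" "b \<in> V - S" using ab(1) TW by auto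
      have "(a, b) \<in> ?E" "(a, s) \<in> ?E" "(s, b) \<in> ?E"
        unfolding eq[symmetric] using ab abV f s by (auto simp: assemble_def)
      moreover have "?E \<inter> (V - S') \<times> (V - S') = T'"
        using simple_onD(7)[OF T'(2)] f' by (intro assemble_restrict(1)[of _ _ S']) auto
      moreover have "a \<in> V - S'" "b \<in> V - S'" "s \<in> V - S'" using ab abV s sS' S by auto
      ultimately have "(a, b) \<in> T'" "(a, s) \<in> T'" "(s, b) \<in> T'" by blast+
      thus False using triangle_not_bridges_only[OF T'(2)] T'(1) by blast
    qed
  qed
  thus ?thesis using card_subset_eq[OF fin(2)] S(2) S'(2) by simp
qed

text \<open>
By \<open>apex_set_unique\<close> different triples of an apex set, a tree with a hub and a pattern of links give
different graphs, so it suffices to count the triples.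
\<close>

lemma card_apex_structures_ge:
  assumes V: "finite V" and k: "k \<le> card V" and fin\<G>: "finite \<G>"
    and \<G>: "\<And>S T f. S \<subseteq> V \<Longrightarrow> card S = k \<Longrightarrow> T \<in> resilient_trees k (V - S) \<Longrightarrow>
        f \<in> PiE (V - S) (hub_links Q k S (V - S) T) \<Longrightarrow> assemble (V - S) T {} f \<in> \<G>"
    and t: "\<And>W. W \<subseteq> V \<Longrightarrow> card W = card V - k \<Longrightarrow> tree_weight W (leaf_factor Q k) = t"
  shows "card \<G> \<ge> (card V choose k) *
    (2 ^ (k * (card V - k)) / 2 ^ (2 * k * (k + 1)) * (t - 2 ^ ((2 * k + 1) * (card V - k))))"
proof -
  define m where "m = card V - k"
  define \<S> where "\<S> = {S. S \<subseteq> V \<and> card S = k}"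
  define P where "P S T = PiE (V - S) (hub_links Q k S (V - S) T)" for S T
  define A where "A = (SIGMA S:\<S>. SIGMA T:resilient_trees k (V - S). P S T)"
  define g where "g = (\<lambda>(S, T, f). assemble (V - S) T {} f)"
  have fin\<S>: "finite \<S>" using V by (auto simp: \<S>_def)
  have finS: "finite S" "card (V - S) = m" if "S \<in> \<S>" for S
    using that V finite_subset[of S V] by (auto simp: \<S>_def m_def card_Diff_subset)
  have finP: "finite (P S T)" if "S \<in> \<S>" for S T
    unfolding P_def using V finS[OF that] by (intro finite_PiE) (auto simp: hub_links_def links_def)
  have finT: "finite (resilient_trees k (V - S))" for S
    using finite_trees[of "V - S"] V by (auto simp: resilient_trees_def)
  have "inj_on g A"
  proof (rule inj_onI)
    fix p p' assume p: "p \<in> A" "p' \<in> A" "g p = g p'"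
    obtain S T f S' T' f' where pp: "p = (S, T, f)" "p' = (S', T', f')" by (cases p, cases p')
    have S: "S \<subseteq> V" "card S = k" "T \<in> resilient_trees k (V - S)" "f \<in> P S T"
      and S': "S' \<subseteq> V" "card S' = k" "T' \<in> resilient_trees k (V - S')" "f' \<in> P S' T'"
      and eq: "assemble (V - S) T {} f = assemble (V - S') T' {} f'"
      using p pp by (auto simp: A_def \<S>_def g_def)
    have T: "T \<in> labelled_trees (V - S)" and T': "T' \<in> labelled_trees (V - S')"
      using S S' by (auto simp: resilient_trees_def)
    have f: "f v \<subseteq> S" if "v \<in> V - S" for v
      using S(4) that hub_links_subset by (fastforce simp: P_def)
    have f': "f' v \<subseteq> S'" if "v \<in> V - S'" for v
      using S'(4) that hub_links_subset by (fastforce simp: P_def)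
    have "hub k T \<subseteq> V - S"
      using resilient_hub[OF S(3)] simple_onD(7)[OF treesD(1)[OF T]] by (auto simp: resilient_def)
    hence fh: "f v = S" if "v \<in> hub k T" for v
      using S(4) that by (auto simp: P_def hub_links_def PiE_def Pi_def)
    have SS: "S = S'"
      by (rule apex_set_unique[OF V S(1,2) S'(1,2) S(3) treesD(2)[OF T'] treesD(1)[OF T'] fh f' eq])
    have W: "T \<subseteq> (V - S) \<times> (V - S)" "T' \<subseteq> (V - S') \<times> (V - S')" "S \<inter> (V - S) = {}" "S' \<inter> (V - S') = {}"
      using simple_onD(7)[OF treesD(1)[OF T]] simple_onD(7)[OF treesD(1)[OF T']] by auto
    note r = assemble_restrict[where S = S and f = f, OF W(1,3) f]
    note r' = assemble_restrict[where S = S' and f = f', OF W(2,4) f']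
    have TT: "T = T'" using r(1) r'(1) eq unfolding SS by (simp only:)
    have "f v = f' v" if v: "v \<in> V - S" for v
    proof -
      have "s \<in> f v \<longleftrightarrow> s \<in> f' v" if "s \<in> S" for s
        using r(2)[OF _ that v] r'(2)[of s v] eq SS that v by auto
      thus ?thesis using f[OF v] f' v SS by blast
    qed
    hence "f = f'" using S(4) S'(4) SS unfolding P_def by (intro extensionalityI[of f "V - S"]) (auto simp: PiE_def)
    thus "p = p'" using pp SS TT by simp
  qed
  moreover have "g ` A \<subseteq> \<G>" using \<G> by (auto simp: A_def g_def \<S>_def P_def)
  ultimately have "card A \<le> card \<G>" using fin\<G> card_inj_on_le by blast
  moreover have "card A = (\<Sum>S\<in>\<S>. \<Sum>T\<in>resilient_trees k (V - S). card (P S T))"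
    unfolding A_def using fin\<S> finT finP by (simp add: finite_SigmaI)
  moreover have "real (\<Sum>T\<in>resilient_trees k (V - S). card (P S T)) \<ge>
      2 ^ (k * m) / 2 ^ (2 * k * (k + 1)) * (t - 2 ^ ((2 * k + 1) * m))" if S: "S \<in> \<S>" for S
  proof -
    have Sk: "card S = k" using S by (simp add: \<S>_def)
    have "2 ^ (k * m) / 2 ^ (2 * k * (k + 1)) * (t - 2 ^ ((2 * k + 1) * m)) \<le>
        2 ^ (k * m) / 2 ^ (2 * k * (k + 1)) *
        (\<Sum>T\<in>resilient_trees k (V - S). leaf_factor Q k ^ card (low_degree (V - S) T))"
      using resilient_tree_weight_ge[OF finite_Diff[OF V] leaf_factor_bounds, of S Q k k] t[of "V - S"] finS[OF S]
      by (intro mult_left_mono) (auto simp: m_def)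
    also have "\<dots> = (\<Sum>T\<in>resilient_trees k (V - S).
        2 ^ (k * m) * leaf_factor Q k ^ card (low_degree (V - S) T) / 2 ^ (2 * k * (k + 1)))"
      by (simp add: sum_distrib_left)
    also have "\<dots> \<le> (\<Sum>T\<in>resilient_trees k (V - S). real (card (P S T)))"
      unfolding P_def finS(2)[OF S, symmetric]
      by (intro sum_mono card_PiE_hub_links finite_Diff V finS(1) S Sk)
    finally show ?thesis by simp
  qed
  hence "(\<Sum>S\<in>\<S>. 2 ^ (k * m) / 2 ^ (2 * k * (k + 1)) * (t - 2 ^ ((2 * k + 1) * m))) \<le>
      (\<Sum>S\<in>\<S>. real (\<Sum>T\<in>resilient_trees k (V - S). card (P S T)))"
    by (rule sum_mono)
  moreover have "card \<S> = card V choose k" unfolding \<S>_def using n_subsets[OF V] by simp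
  ultimately have "(card V choose k) * (2 ^ (k * m) / 2 ^ (2 * k * (k + 1)) * (t - 2 ^ ((2 * k + 1) * m))) \<le>
      real (card A)" by simp
  also have "\<dots> \<le> card \<G>" using \<open>card A \<le> card \<G>\<close> by simp
  finally show ?thesis by (simp only: m_def)
qed

lemma assemble_apex_edges:
  assumes V: "finite V" and S: "S \<subseteq> V" "card S = k" and T: "T \<in> resilient_trees k (V - S)"
    and f: "f \<in> PiE (V - S) (hub_links Q k S (V - S) T)"
  shows "assemble (V - S) T {} f \<in> apex_edges k V"
proof -
  have T': "T \<in> labelled_trees (V - S)" using T by (auto simp: resilient_trees_def)
  have f': "f v \<subseteq> S" if "v \<in> V - S" for v
    using f that hub_links_subset by fastforce
  have "simple_on V (assemble (V - S) T {} f)"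
    by (rule simple_on_assemble[where S = S, OF treesD(1)[OF T']]) (use S f' in auto)
  moreover have "assemble (V - S) T {} f \<inter> (V - S) \<times> (V - S) = T"
    using simple_onD(7)[OF treesD(1)[OF T']] f' by (intro assemble_restrict(1)[of _ _ S]) auto
  ultimately show ?thesis using S treesD(2)[OF T'] by (auto simp: apex_edges_def)
qed

text \<open>
Let \<open>x\<close> be deleted, and let \<open>a\<close> be a vertex of the hub other than \<open>x\<close>. All other apex vertices are adjacent to \<open>a\<close>. If \<open>x\<close> is
an apex vertex, the tree is intact and connects the rest to \<open>a\<close>. If \<open>x\<close> is in the tree, every other tree vertex
still reaches a leaf by \<open>tree_reaches_leaf_avoiding\<close>, and the leaf is linked to an apex vertex.
\<close>

lemma biconnected_assemble:
  assumes V: "finite V" and S: "S \<subseteq> V" "card S = k" and T: "T \<in> resilient_trees k (V - S)"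
    and f: "f \<in> PiE (V - S) (hub_links True k S (V - S) T)"
    and k: "1 \<le> k" and W2: "2 \<le> card (V - S)"
  shows "biconnected V (assemble (V - S) T {} f)"
proof -
  define W where "W = V - S"
  define E where "E = assemble W T {} f"
  have T': "T \<in> labelled_trees W" using T by (auto simp: resilient_trees_def W_def)
  have TW: "T \<subseteq> W \<times> W" using simple_onD(7)[OF treesD(1)[OF T']] .
  have f': "f v \<subseteq> S" if "v \<in> W" for v
    using f that hub_links_subset unfolding W_def by fastforce
  have fin: "finite S" "finite W" using V S finite_subset by (auto simp: W_def)
  have Sne: "S \<noteq> {}" using S(2) k by auto
  let ?U = "hub k T"
  have U: "?U \<subseteq> Domain T" and
    res: "\<And>R. finite R \<Longrightarrow> card R \<le> k \<Longrightarrow> \<exists>(a, b)\<in>T. a \<in> ?U - R \<and> b \<in> ?U - R"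
    using resilient_hub[OF T] unfolding resilient_def by blast+
  have UW: "?U \<subseteq> W" using U TW by auto
  have fU: "f v = S" if "v \<in> ?U" for v
    using f that UW by (auto simp: hub_links_def W_def PiE_def Pi_def)
  have flow: "f v \<noteq> {}" if "v \<in> low_degree W T" for v
  proof -
    have "v \<in> V - S" using that by (simp add: low_degree_def W_def)
    hence "f v \<in> hub_links True k S W T v" using f unfolding W_def by blast
    show ?thesis
    proof (cases "v \<in> ?U")
      case True
      thus ?thesis using fU Sne by simp
    next
      case False
      hence "f v \<in> Pow S - {{}}"
        using \<open>f v \<in> hub_links True k S W T v\<close> that
        by (simp add: hub_links_def links_def must_link_def)
      thus ?thesis by simp
    qed
  qed
  have simple: "simple_on V E"
    unfolding E_def by (rule simple_on_assemble[where S = S, OF treesD(1)[OF T']]) (use S f' in \<open>auto simp: W_def\<close>)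
  have TE: "T \<subseteq> E" by (auto simp: E_def assemble_def)
  have link: "(v, s) \<in> E" "(s, v) \<in> E" if "v \<in> W" "s \<in> f v" for v s
    using that by (auto simp: E_def assemble_def)
  have VSW: "V = S \<union> W" "S \<inter> W = {}" using S by (auto simp: W_def)
  have removed: "(u, w) \<in> (E \<inter> (V - {x}) \<times> (V - {x}))\<^sup>*"
    if "x \<in> V" "u \<in> V - {x}" "w \<in> V - {x}" for x u w
  proof -
    define D where "D = E \<inter> (V - {x}) \<times> (V - {x})"
    have symD: "sym D" using simple_onD(1)[OF simple] by (auto simp: D_def sym_def)
    have "card {x} \<le> k" using k by simp
    then obtain a where a: "a \<in> ?U - {x}" using res[of "{x}"] by auto
    have aW: "a \<in> W" "a \<noteq> x" using a UW by auto
    have sa: "(s, a) \<in> D\<^sup>*" if "s \<in> S" "s \<noteq> x" for s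
    proof -
      have "(s, a) \<in> D" using link(2)[OF aW(1), of s] fU[of a] a that aW VSW by (auto simp: D_def)
      thus ?thesis by (rule r_into_rtrancl)
    qed
    have wa: "(v, a) \<in> D\<^sup>*" if v: "v \<in> W" "v \<noteq> x" for v
    proof (cases "x \<in> S")
      case True
      have "T \<subseteq> D" using TE TW VSW True by (auto simp: D_def)
      thus ?thesis using treesD(3)[OF T' v(1) aW(1)] rtrancl_mono by blast
    next
      case False
      hence xW: "x \<in> W" using that VSW \<open>x \<in> V\<close> by auto
      obtain l where l: "l \<in> low_degree W T" "l \<noteq> x" "(v, l) \<in> (T \<inter> (W - {x}) \<times> (W - {x}))\<^sup>*"
        using tree_reaches_leaf_avoiding[OF fin(2) W2[folded W_def] T' v xW] by blast
      have lW: "l \<in> W" using l(1) by (simp add: low_degree_def)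
      obtain s where s: "s \<in> f l" using flow[OF l(1)] by blast
      have sS: "s \<in> S" using f'[OF lW] s by blast
      hence "s \<noteq> x" using xW VSW by auto
      have "T \<inter> (W - {x}) \<times> (W - {x}) \<subseteq> D" using TE VSW by (auto simp: D_def)
      hence "(v, l) \<in> D\<^sup>*" using l(3) rtrancl_mono by blast
      moreover have "(l, s) \<in> D" using link(1)[OF lW s] l(2) lW sS \<open>s \<noteq> x\<close> VSW(1) by (simp add: D_def)
      moreover have "(s, a) \<in> D\<^sup>*" by (rule sa[OF sS \<open>s \<noteq> x\<close>])
      ultimately show ?thesis by (meson rtrancl_into_rtrancl rtrancl_trans)
    qed
    have all: "(v, a) \<in> D\<^sup>*" if "v \<in> V - {x}" for v
      using that VSW sa wa by blast
    have "(u, a) \<in> D\<^sup>*" "(w, a) \<in> D\<^sup>*" using all that by blast+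
    thus ?thesis using sym_rtrancl_iff[OF symD] unfolding D_def[symmetric] by (meson rtrancl_trans)
  qed
  have cardV: "3 \<le> card V"
    using card_Diff_subset[OF fin(1) S(1)] S(2) W2 k by linarith
  have "(u, w) \<in> E\<^sup>*" if "u \<in> V" "w \<in> V" for u w
  proof -
    have "card {u, w} < card V" using cardV by (auto simp: card_insert_if)
    hence "\<not> V \<subseteq> {u, w}" using card_mono[of "{u, w}" V] by auto
    then obtain x where "x \<in> V" "x \<noteq> u" "x \<noteq> w" by blast
    hence "(u, w) \<in> (E \<inter> (V - {x}) \<times> (V - {x}))\<^sup>*" using removed that by blast
    moreover have "(E \<inter> (V - {x}) \<times> (V - {x}))\<^sup>* \<subseteq> E\<^sup>*" by (rule rtrancl_mono) auto
    ultimately show ?thesis by blast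
  qed
  hence "biconnected V E" using removed cardV by (auto simp: biconnected_def)
  thus ?thesis by (simp add: E_def W_def)
qed

text \<open>
A vertex without links and with at most one neighbour is isolated after the deletion of that neighbour.
\<close>

lemma biconnected_low_linked:
  assumes V: "finite V" "3 \<le> card V" and E: "simple_on V E" "biconnected V E"
    and v: "v \<in> low_degree W (E \<inter> W \<times> W)" and W: "W = V - S"
  shows "\<exists>s\<in>S. (s, v) \<in> E"
proof (rule ccontr)
  assume none: "\<not> ?thesis"
  note s = simple_onD[OF E(1)]
  have vW: "v \<in> V" "v \<in> W" using v W by (auto simp: low_degree_def)
  have nb: "E `` {v} = (E \<inter> W \<times> W) `` {v}"
    using none s(4,5) vW W by blast
  have fin: "finite (E `` {v})" using simple_on_finite[OF E(1) V(1)] by (rule finite_Image)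
  have c1: "card (E `` {v}) \<le> 1" using v nb by (simp add: low_degree_def)
  have "\<exists>y\<in>V - {v}. E `` {v} \<subseteq> {y}"
  proof (cases "E `` {v} = {}")
    case True
    have "\<not> V \<subseteq> {v}" using V card_mono[of "{v}" V] by auto
    thus ?thesis using True by blast
  next
    case False
    hence "card (E `` {v}) = 1" using c1 fin by (simp add: le_Suc_eq)
    then obtain y where y: "E `` {v} = {y}" by (auto simp: card_1_singleton_iff)
    hence "(v, y) \<in> E" by blast
    thus ?thesis using y s(4,6) by (intro bexI[of _ y]) auto
  qed
  then obtain y where y: "y \<in> V" "y \<noteq> v" "E `` {v} \<subseteq> {y}" by blast
  have "\<not> V \<subseteq> {v, y}" using V card_mono[of "{v, y}" V] y by auto
  then obtain z where z: "z \<in> V" "z \<noteq> v" "z \<noteq> y" by blast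
  have "(v, z) \<in> (E \<inter> (V - {y}) \<times> (V - {y}))\<^sup>*"
    using E(2) y z vW unfolding biconnected_def by blast
  thus False using z y by (cases rule: converse_rtranclE) auto
qed

text \<open>
Deleting further vertices from a forest leaves a forest, so the apex set may be enlarged to exactly \<open>k\<close>
vertices.
\<close>

lemma apex_edges_exact:
  assumes V: "finite V" "k \<le> card V" and E: "E \<in> apex_edges k V"
  obtains S where "S \<subseteq> V" "card S = k" "bridges_only (E \<inter> (V - S) \<times> (V - S))"
proof -
  obtain S where S: "S \<subseteq> V" "card S \<le> k" "bridges_only (E \<inter> (V - S) \<times> (V - S))"
    using E by (auto simp: apex_edges_def)
  obtain S' where S': "S \<subseteq> S'" "S' \<subseteq> V" "card S' = k"
    using exists_subset_between[OF S(2) V(2) S(1) V(1)] by blast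
  have "bridges_only (E \<inter> (V - S') \<times> (V - S'))"
    by (rule bridges_only_mono[OF S(3)]) (use S' in auto)
  thus thesis using that S' by blast
qed

lemma finite_apex_edges: "finite V \<Longrightarrow> finite (apex_edges k V)"
  unfolding apex_edges_def by (rule finite_simple_on)

section \<open>Asymptotics\<close>

lemma eta_less_1:
  assumes "1 \<le> k"
  shows "eta k < 1"
proof -
  let ?f = "\<lambda>x::real. 2 ^ k * x - exp (x - 1)"
  have k2: "(2::real) \<le> 2 ^ k" using power_increasing[of 1 k "2::real"] assms by simp
  have "continuous_on {0..1} ?f" by (intro continuous_intros)
  moreover have "?f 0 \<le> 0" "0 \<le> ?f 1" using k2 by auto
  ultimately obtain x where x: "0 \<le> x" "x \<le> 1" "?f x = 0"
    using IVT'[of ?f 0 0 1] by auto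
  have "x \<noteq> 0" "x \<noteq> 1" using x(3) k2 by auto
  thus ?thesis using eta_least(3)[OF assms, of x] x by auto
qed

lemma defect_eta:
  assumes "1 \<le> k"
  shows "defect (1 - eta k) = 1 / 2 ^ k"
proof -
  have "exp (eta k - 1) * exp (1 - eta k) = 1" by (simp flip: exp_add)
  hence "2 ^ k * (eta k * exp (1 - eta k)) = 1" using eta_least(2)[OF assms] by (simp add: mult.assoc[symmetric])
  thus ?thesis by (simp add: defect_def field_simps)
qed

lemma zeta_eta:
  assumes "1 \<le> k"
  shows "exp 1 * 2 ^ k * eta k = exp (eta k)"
  using eta_least(2)[OF assms] by (simp add: mult.assoc flip: exp_add)

lemma power_over_self_power_tendsto_0:
  fixes D :: real
  assumes D: "0 \<le> D"
  shows "(\<lambda>m. D ^ m / real m ^ (m - 2)) \<longlonglongrightarrow> 0"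
proof (rule Lim_null_comparison)
  show "\<forall>\<^sub>F m in sequentially. norm (D ^ m / real m ^ (m - 2)) \<le> D\<^sup>2 * (1 / 2) ^ (m - 2)"
    using eventually_ge_at_top[of "nat \<lceil>2 * D\<rceil> + 2"]
  proof eventually_elim
    case (elim m)
    have m: "2 * D \<le> real m" "m > 0" using elim by linarith+
    have "m = 2 + (m - 2)" using elim by linarith
    hence "D ^ m = D\<^sup>2 * D ^ (m - 2)" by (metis power_add)
    hence "D ^ m / real m ^ (m - 2) = D\<^sup>2 * (D / real m) ^ (m - 2)"
      by (simp add: power_divide)
    also have "\<dots> \<le> D\<^sup>2 * (1 / 2) ^ (m - 2)"
      using m D by (intro mult_left_mono power_mono) (auto simp: field_simps)
    finally show ?case using D by simp
  qed
  have "(\<lambda>m. (1 / 2 :: real) ^ (m - 2)) \<longlonglongrightarrow> 0"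
    by (rule LIMSEQ_offset[of _ 2]) (simp add: LIMSEQ_power_zero)
  thus "(\<lambda>m. D\<^sup>2 * (1 / 2) ^ (m - 2)) \<longlonglongrightarrow> 0" by (rule tendsto_mult_right_zero)
qed

text \<open>
Let \<open>a\<close> and \<open>b\<close> be the tree weights on \<open>m = n - k\<close> vertices for all \<open>k\<close>-apex forests and for the
\<open>2\<close>-connected ones, and let \<open>e\<close> be the bound for the trees without a hub. Both counts of graphs are, up to constants,
the common factor \<open>C n\<close> times \<open>a\<close> or \<open>b\<close>, where the lower bounds lose \<open>e\<close>. Since \<open>b / a\<close> is of the order
\<open>exp (- \<eta> m)\<close> and \<open>e / a\<close> is of smaller order, the quotient of the counts has the order of \<open>b / a\<close>.
\<close>

lemma prob_two_connected_bigtheta: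
  assumes k: "1 \<le> k"
  shows "(\<lambda>n. prob_two_connected k n) \<in> \<Theta>(\<lambda>n. exp (- eta k * real n))"
proof -
  define \<eta> where "\<eta> = eta k"
  define r where "r = 1 - \<eta>"
  have \<eta>: "0 < \<eta>" "\<eta> < 1" using eta_least(1)[OF k] eta_less_1[OF k] by (auto simp: \<eta>_def)
  have r: "0 < r" using \<eta> by (simp add: r_def)
  define a where "a m = real m ^ (m - 2)" for m :: nat
  define b where "b m = tree_number m (defect r)" for m
  define e where "e m = (2::real) ^ ((2 * k + 1) * m)" for m
  define C where "C n = real (n choose k) * 2 ^ (k * (n - k))" for n
  define c1 :: real where "c1 = 2 ^ k\<^sup>2 * exp 2"
  define c2 :: real where "c2 = 1 / 2 ^ (2 * k * (k + 1))"
  define A where "A n = real (card (apex_edges k {1..n}))" for n :: nat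
  define B where "B n = real (card {E \<in> apex_edges k {1..n}. biconnected {1..n} E})" for n :: nat
  define L where "L = r\<^sup>2 / sqrt r"
  have pos: "c1 > 0" "c2 > 0" "L > 0" using r by (auto simp: c1_def c2_def L_def)
  have weight1: "tree_weight W (leaf_factor False k) = a m" if "card W = m" "3 \<le> m" for W :: "nat set" and m
  proof -
    have "finite W" using that by (intro card_ge_0_finite) auto
    thus ?thesis using tree_weight_eq[of W 0] that by (simp add: leaf_factor_def a_def)
  qed
  have weight2: "tree_weight W (leaf_factor True k) = b m" if "card W = m" "3 \<le> m" for W :: "nat set" and m
  proof -
    have "finite W" using that by (intro card_ge_0_finite) auto
    thus ?thesis using tree_weight_eq[of W "1 / 2 ^ k"] that defect_eta[OF k]
      by (simp add: leaf_factor_def b_def r_def \<eta>_def)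
  qed
  have bounds: "A n \<le> C n * (c1 * a (n - k))" "C n * (c2 * (a (n - k) - e (n - k))) \<le> A n"
    "B n \<le> C n * (c1 * b (n - k))" "C n * (c2 * (b (n - k) - e (n - k))) \<le> B n"
    if n: "k + 3 \<le> n" for n
  proof -
    let ?V = "{1..n}"
    have V: "finite ?V" "k < card ?V" "k \<le> card ?V" "3 \<le> card ?V" "3 \<le> n - k" using n by auto
    have fin: "finite (apex_edges k ?V)" by (rule finite_apex_edges) simp
    have "A n \<le> (card ?V choose k) * (2 ^ k\<^sup>2 * 2 ^ (k * (card ?V - k)) * exp 2 * a (n - k))"
      unfolding A_def
    proof (rule card_apex_structures_le[where Q = False, OF V(1,2)])
      fix E assume E: "E \<in> apex_edges k ?V"
      obtain S where "S \<subseteq> ?V" "card S = k" "bridges_only (E \<inter> (?V - S) \<times> (?V - S))"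
        using apex_edges_exact[OF V(1,3) E] .
      moreover have "simple_on ?V E" using E by (simp add: apex_edges_def)
      ultimately show "simple_on ?V E \<and> (\<exists>S\<subseteq>?V. card S = k \<and>
          bridges_only (E \<inter> (?V - S) \<times> (?V - S)) \<and>
          (\<forall>v\<in>must_link False (?V - S) (E \<inter> (?V - S) \<times> (?V - S)). \<exists>s\<in>S. (s, v) \<in> E))"
        by (auto simp: must_link_def)
    qed (use V weight1 in auto)
    thus "A n \<le> C n * (c1 * a (n - k))" by (simp add: C_def c1_def mult_ac)
    have "B n \<le> (card ?V choose k) * (2 ^ k\<^sup>2 * 2 ^ (k * (card ?V - k)) * exp 2 * b (n - k))"
      unfolding B_def
    proof (rule card_apex_structures_le[where Q = True, OF V(1,2)])
      fix E assume "E \<in> {E \<in> apex_edges k ?V. biconnected ?V E}"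
      hence E: "E \<in> apex_edges k ?V" "biconnected ?V E" by auto
      obtain S where S: "S \<subseteq> ?V" "card S = k" "bridges_only (E \<inter> (?V - S) \<times> (?V - S))"
        using apex_edges_exact[OF V(1,3) E(1)] .
      have simple: "simple_on ?V E" using E by (simp add: apex_edges_def)
      have "\<forall>v\<in>must_link True (?V - S) (E \<inter> (?V - S) \<times> (?V - S)). \<exists>s\<in>S. (s, v) \<in> E"
        using biconnected_low_linked[OF V(1,4) simple E(2) _ refl] by (simp add: must_link_def)
      thus "simple_on ?V E \<and> (\<exists>S\<subseteq>?V. card S = k \<and>
          bridges_only (E \<inter> (?V - S) \<times> (?V - S)) \<and>
          (\<forall>v\<in>must_link True (?V - S) (E \<inter> (?V - S) \<times> (?V - S)). \<exists>s\<in>S. (s, v) \<in> E))"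
        using simple S by blast
    qed (use V weight2 in auto)
    thus "B n \<le> C n * (c1 * b (n - k))" by (simp add: C_def c1_def mult_ac)
    have "(card ?V choose k) * (2 ^ (k * (card ?V - k)) / 2 ^ (2 * k * (k + 1)) *
        (a (n - k) - 2 ^ ((2 * k + 1) * (card ?V - k)))) \<le> A n"
      unfolding A_def
    proof (rule card_apex_structures_ge[where Q = False, OF V(1,3) fin])
      show "assemble (?V - S) T {} f \<in> apex_edges k ?V"
        if "S \<subseteq> ?V" "card S = k" "T \<in> resilient_trees k (?V - S)"
          "f \<in> PiE (?V - S) (hub_links False k S (?V - S) T)" for S T f
        by (rule assemble_apex_edges[OF V(1) that])
    qed (use V weight1 in auto)
    thus "C n * (c2 * (a (n - k) - e (n - k))) \<le> A n" by (simp add: C_def c2_def e_def mult_ac)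
    have "(card ?V choose k) * (2 ^ (k * (card ?V - k)) / 2 ^ (2 * k * (k + 1)) *
        (b (n - k) - 2 ^ ((2 * k + 1) * (card ?V - k)))) \<le> B n"
      unfolding B_def
    proof (rule card_apex_structures_ge[where Q = True, OF V(1,3)])
      show "finite {E \<in> apex_edges k ?V. biconnected ?V E}" using fin by simp
      show "assemble (?V - S) T {} f \<in> {E \<in> apex_edges k ?V. biconnected ?V E}"
        if S: "S \<subseteq> ?V" "card S = k" and T: "T \<in> resilient_trees k (?V - S)"
          and f: "f \<in> PiE (?V - S) (hub_links True k S (?V - S) T)" for S T f
      proof -
        have "card (?V - S) = card ?V - card S" using S(1) by (intro card_Diff_subset finite_subset[OF S(1)]) auto
        hence "2 \<le> card (?V - S)" using V(5) S(2) by simp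
        thus ?thesis
          using assemble_apex_edges[OF V(1) S T f] biconnected_assemble[OF V(1) S T f k] by blast
      qed
    qed (use V weight2 in auto)
    thus "C n * (c2 * (b (n - k) - e (n - k))) \<le> B n" by (simp add: C_def c2_def e_def mult_ac)
  qed
  have lim_b: "(\<lambda>m. b m / a m * exp (\<eta> * m)) \<longlonglongrightarrow> L"
    using tree_number_tendsto[OF r] by (simp add: a_def b_def L_def r_def)
  have lim_e: "(\<lambda>m. e m / a m * exp (\<eta> * m)) \<longlonglongrightarrow> 0"
  proof -
    have "e m / a m * exp (\<eta> * m) = (2 ^ (2 * k + 1) * exp \<eta>) ^ m / real m ^ (m - 2)" for m
      unfolding e_def a_def power_mult power_mult_distrib
      by (simp add: exp_of_nat_mult[symmetric] mult.commute)
    thus ?thesis using power_over_self_power_tendsto_0[of "2 ^ (2 * k + 1) * exp \<eta>"] by simp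
  qed
  have ev: "\<forall>\<^sub>F m in sequentially. L / 2 < b m / a m * exp (\<eta> * m) \<and> b m / a m * exp (\<eta> * m) < 2 * L \<and>
      e m / a m * exp (\<eta> * m) < min (1 / 2) (L / 4) \<and> 3 \<le> m"
    using pos(3)
    by (intro eventually_conj order_tendstoD[OF lim_b] order_tendstoD[OF lim_e] eventually_ge_at_top) auto
  have ratio: "c2 * L / (4 * c1) \<le> B n / A n * exp (\<eta> * (n - k)) \<and>
      B n / A n * exp (\<eta> * (n - k)) \<le> 4 * c1 * L / c2"
    if m: "m = n - k" and n: "k + 3 \<le> n" and
      h: "L / 2 < b m / a m * exp (\<eta> * m)" "b m / a m * exp (\<eta> * m) < 2 * L"
        "e m / a m * exp (\<eta> * m) < min (1 / 2) (L / 4)" for m n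
  proof -
    define x where "x = exp (\<eta> * m)"
    have x1: "1 \<le> x" using \<eta> by (simp add: x_def)
    have am: "a m > 0" using m n by (simp add: a_def)
    have Cn: "C n > 0" using n by (simp add: C_def)
    have e0: "e m / a m \<ge> 0" using am by (simp add: e_def)
    have h': "L / 2 * a m < b m * x" "b m * x < 2 * L * a m" "e m * x < L / 4 * a m" "e m * x < a m / 2"
      using h am by (simp_all add: x_def field_simps)
    have "e m * 1 \<le> e m * x" using x1 by (intro mult_left_mono) (auto simp: e_def)
    hence ea: "e m < a m / 2" using h'(4) by simp
    have A1: "A n \<le> C n * c1 * a m" and B1: "B n \<le> C n * c1 * b m"
      and A2: "C n * c2 * (a m - e m) \<le> A n" and B2: "C n * c2 * (b m - e m) \<le> B n"
      using bounds[OF n] m by (simp_all add: mult.assoc)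
    have "C n * c2 * (a m / 2) \<le> C n * c2 * (a m - e m)"
      using ea Cn pos by (intro mult_left_mono) auto
    hence A2': "C n * c2 * (a m / 2) \<le> A n" using A2 by linarith
    have A0: "0 < A n" using A2' Cn pos am by (smt (verit) half_gt_zero mult_pos_pos)
    have "C n * c2 * (L / 4 * a m) \<le> C n * c2 * ((b m - e m) * x)"
      using h'(1,3) Cn pos by (intro mult_left_mono) (auto simp: left_diff_distrib)
    also have "\<dots> = C n * c2 * (b m - e m) * x" by simp
    also have "\<dots> \<le> B n * x" using B2 x1 by (intro mult_right_mono) auto
    finally have B2': "C n * c2 * (L / 4 * a m) \<le> B n * x" .
    have "B n * x \<le> C n * c1 * b m * x" using B1 x1 by (intro mult_right_mono) auto
    also have "\<dots> = C n * c1 * (b m * x)" by simp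
    also have "\<dots> \<le> C n * c1 * (2 * L * a m)" using h'(2) Cn pos by (intro mult_left_mono) auto
    finally have B1': "B n * x \<le> C n * c1 * (2 * L * a m)" .
    have "c2 * L / (4 * c1) * A n \<le> c2 * L / (4 * c1) * (C n * c1 * a m)"
      using A1 pos by (intro mult_left_mono) auto
    also have "\<dots> = C n * c2 * (L / 4 * a m)" using pos by simp
    also note B2'
    finally have low: "c2 * L / (4 * c1) * A n \<le> B n * x" .
    note B1'
    also have "C n * c1 * (2 * L * a m) = 4 * c1 * L / c2 * (C n * c2 * (a m / 2))" using pos by simp
    also have "\<dots> \<le> 4 * c1 * L / c2 * A n" using A2' pos by (intro mult_left_mono) auto
    finally have up: "B n * x \<le> 4 * c1 * L / c2 * A n" .
    have ex: "exp (\<eta> * real (n - k)) = x" by (simp add: m x_def)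
    show ?thesis unfolding ex using low up A0 by (simp add: pos_le_divide_eq pos_divide_le_eq)
  qed
  have ev_n: "\<forall>\<^sub>F n in sequentially. c2 * L / (4 * c1) \<le> B n / A n * exp (\<eta> * (n - k)) \<and>
      B n / A n * exp (\<eta> * (n - k)) \<le> 4 * c1 * L / c2"
  proof -
    have "filterlim (\<lambda>n. n - k) at_top sequentially" by (rule filterlim_minus_const_nat_at_top)
    from filterlim_iff[THEN iffD1, OF this, rule_format, OF ev] eventually_ge_at_top[of "k + 3"]
    show ?thesis by eventually_elim (rule ratio[OF refl], auto)
  qed
  let ?K = "exp (\<eta> * k)"
  have "(\<lambda>n. prob_two_connected k n) \<in> \<Theta>(\<lambda>n. exp (- \<eta> * real n))"
  proof (rule bigthetaI')
    show "0 < c2 * L / (4 * c1) * ?K" "0 < 4 * c1 * L / c2 * ?K" using pos by auto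
    show "\<forall>\<^sub>F n in sequentially.
        c2 * L / (4 * c1) * ?K * norm (exp (- \<eta> * real n)) \<le> norm (prob_two_connected k n) \<and>
        norm (prob_two_connected k n) \<le> 4 * c1 * L / c2 * ?K * norm (exp (- \<eta> * real n))"
      using ev_n eventually_ge_at_top[of k]
    proof eventually_elim
      case (elim n)
      have nk: "real (n - k) = real n - real k" using elim by simp
      define p where "p = B n / A n"
      define E where "E = ?K * exp (- \<eta> * real n)"
      have P: "prob_two_connected k n = p"
        by (simp add: prob_two_connected_eq A_def B_def p_def)
      have p0: "0 \<le> p" by (simp add: A_def B_def p_def)
      have E0: "0 \<le> E" by (simp add: E_def)
      have "exp (\<eta> * (real n - real k)) * E = 1"
        by (simp add: E_def algebra_simps flip: exp_add)
      hence pE: "p * exp (\<eta> * (real n - real k)) * E = p" by (simp only: mult.assoc mult_1_right)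
      have "c2 * L / (4 * c1) * E \<le> p * exp (\<eta> * (real n - real k)) * E"
        using elim E0 unfolding nk p_def[symmetric] by (intro mult_right_mono) blast+
      moreover have "p * exp (\<eta> * (real n - real k)) * E \<le> 4 * c1 * L / c2 * E"
        using elim E0 unfolding nk p_def[symmetric] by (intro mult_right_mono) blast+
      ultimately have "c2 * L / (4 * c1) * E \<le> p" "p \<le> 4 * c1 * L / c2 * E"
        unfolding pE by blast+
      thus ?case
        unfolding P real_norm_def abs_exp_cancel abs_of_nonneg[OF p0] E_def by (simp only: mult.assoc)
    qed
  qed
  thus ?thesis by (simp add: \<eta>_def)
qed

theorem corollary7:
  fixes k :: nat
  assumes "1 \<le> k"
  shows "(\<lambda>n. prob_two_connected k n) \<in> \<Theta>(\<lambda>n. (zeta k * eta k) powi (- int n)) \<and>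
         (\<lambda>n. prob_two_connected k n) \<in> \<Theta>(\<lambda>n. (exp 1 * 2 ^ k * eta k) powi (- int n)) \<and>
         (\<lambda>n. prob_two_connected k n) \<in> \<Theta>(\<lambda>n. exp (- (eta k) * real n))"
proof -
  have pow: "(exp 1 * 2 ^ k * eta k) powi (- int n) = exp (- (eta k) * real n)" for n
    unfolding zeta_eta[OF assms]
    by (simp add: power_int_minus exp_minus mult.commute flip: exp_of_nat_mult)
  thus ?thesis using prob_two_connected_bigtheta[OF assms] by (simp add: zeta_def)
qed

end
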